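(* Let $\lambda>0$, $G_0\in L^2(-1,1)$ and $\wp\in\mathbb{R}$. Then there exists a (weak) solution $G\in C\big((0,\infty);L^2(-1,1)\big)\cap L^2_{\rm loc}\big((0,\infty);H^1_\rho(-1,1)\big)$, with $\partial_tG\in L^2_{\rm loc}\big((0,\infty);H^{-1}(-1,1)\big)$, of $$\begin{cases}\dfrac{\partial G}{\partial t} = \dfrac{\lambda}{2}(1-x^2)\dfrac{\partial^2G}{\partial x^2}, & t>0,\ x\in(-1,1),\\ G(x,0)=G_0(x), & x\in(-1,1),\\ G(1,t)=1,\quad G(-1,t)=\wp, & t>0.\end{cases}$$ If moreover $G_0\in H^1(-1,1)$, then $\partial_xG\in L^2_{\rm loc}\big((0,\infty);H^1_\rho(-1,1)\big)$, $G\in C\big((0,\infty);H^1(-1,1)\big)$ and $\partial_tG\in L^2_{\rm loc}\big((0,\infty);L^2(-1,1)\big)$.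
   Context: The weighted Sobolev space is $H^1_\rho(-1,1) := \{v\in L^2(-1,1): \sqrt{1-x^2}\,\partial_x v\in L^2(-1,1)\}$. The boundary values $G(\pm1,t)$ are understood as traces. *)

theory Defs
  imports "HOL-Analysis.Analysis"
begin

text \<open>Spatial domain (-1,1). Functions of space are of type real => real (values
outside (-1,1) irrelevant); space-time functions are G :: real => real => real, read G x t.\<close>

abbreviation Ioo11 :: "real set" where "Ioo11 \<equiv> {-1<..<1}"

definition L2 :: "(real \<Rightarrow> real) \<Rightarrow> bool" where
  "L2 f \<longleftrightarrow> set_borel_measurable lborel Ioo11 f \<and> set_integrable lborel Ioo11 (\<lambda>x. (f x)^2)"

definition L2_dist :: "(real \<Rightarrow> real) \<Rightarrow> (real \<Rightarrow> real) \<Rightarrow> real" where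
  "L2_dist f g = sqrt (LINT x:Ioo11|lborel. (f x - g x)^2)"

definition smooth_fun :: "(real \<Rightarrow> real) \<Rightarrow> bool" where
  "smooth_fun f \<longleftrightarrow> (\<forall>n x. ((deriv ^^ n) f) differentiable (at x))"

definition test_fun_x :: "(real \<Rightarrow> real) \<Rightarrow> bool" where
  "test_fun_x v \<longleftrightarrow> smooth_fun v \<and> (\<exists>a b. -1 < a \<and> b < 1 \<and> (\<forall>x. x \<notin> {a..b} \<longrightarrow> v x = 0))"

definition test_fun_t :: "(real \<Rightarrow> real) \<Rightarrow> bool" where
  "test_fun_t w \<longleftrightarrow> smooth_fun w \<and> (\<exists>a b. 0 < a \<and> (\<forall>t. t \<notin> {a..b} \<longrightarrow> w t = 0))"

definition loc_int :: "(real \<Rightarrow> real) \<Rightarrow> bool" where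
  "loc_int f \<longleftrightarrow> (\<forall>a b. -1 < a \<longrightarrow> b < 1 \<longrightarrow> set_integrable lborel {a..b} f)"

definition weak_deriv :: "(real \<Rightarrow> real) \<Rightarrow> (real \<Rightarrow> real) \<Rightarrow> bool" where
  "weak_deriv f g \<longleftrightarrow> loc_int f \<and> loc_int g \<and>
     (\<forall>\<phi>. test_fun_x \<phi> \<longrightarrow>
        (LINT x:Ioo11|lborel. f x * deriv \<phi> x) = - (LINT x:Ioo11|lborel. g x * \<phi> x))"

definition H1rho :: "(real \<Rightarrow> real) \<Rightarrow> bool" where
  "H1rho f \<longleftrightarrow> L2 f \<and> (\<exists>g. weak_deriv f g \<and> L2 (\<lambda>x. sqrt (1 - x^2) * g x))"

definition H1 :: "(real \<Rightarrow> real) \<Rightarrow> bool" where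
  "H1 f \<longleftrightarrow> L2 f \<and> (\<exists>g. weak_deriv f g \<and> L2 g)"

definition wderiv :: "(real \<Rightarrow> real) \<Rightarrow> (real \<Rightarrow> real)" where
  "wderiv f = (SOME g. weak_deriv f g)"

definition H1_dist :: "(real \<Rightarrow> real) \<Rightarrow> (real \<Rightarrow> real) \<Rightarrow> real" where
  "H1_dist f g = sqrt ((L2_dist f g)^2 + (L2_dist (wderiv f) (wderiv g))^2)"

definition trace_at_1 :: "(real \<Rightarrow> real) \<Rightarrow> real \<Rightarrow> bool" where
  "trace_at_1 f c \<longleftrightarrow> (\<exists>h. continuous_on Ioo11 h \<and> (AE x in lborel. x \<in> Ioo11 \<longrightarrow> f x = h x)
                        \<and> (h \<longlongrightarrow> c) (at_left 1))"

definition trace_at_m1 :: "(real \<Rightarrow> real) \<Rightarrow> real \<Rightarrow> bool" where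
  "trace_at_m1 f c \<longleftrightarrow> (\<exists>h. continuous_on Ioo11 h \<and> (AE x in lborel. x \<in> Ioo11 \<longrightarrow> f x = h x)
                        \<and> (h \<longlongrightarrow> c) (at_right (-1)))"

definition L2loc_L2 :: "(real \<Rightarrow> real \<Rightarrow> real) \<Rightarrow> bool" where
  "L2loc_L2 F \<longleftrightarrow>
     set_borel_measurable (lborel \<Otimes>\<^sub>M lborel) (Ioo11 \<times> {0<..}) (\<lambda>(x,t). F x t) \<and>
     (\<forall>a b. 0 < a \<longrightarrow> set_integrable (lborel \<Otimes>\<^sub>M lborel) (Ioo11 \<times> {a..b}) (\<lambda>(x,t). (F x t)^2))"

definition C_L2 :: "(real \<Rightarrow> real \<Rightarrow> real) \<Rightarrow> bool" where
  "C_L2 G \<longleftrightarrow> (\<forall>t>0. L2 (\<lambda>x. G x t)) \<and>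
     (\<forall>t>0. ((\<lambda>s. L2_dist (\<lambda>x. G x s) (\<lambda>x. G x t)) \<longlongrightarrow> 0) (at t))"

definition C_H1 :: "(real \<Rightarrow> real \<Rightarrow> real) \<Rightarrow> bool" where
  "C_H1 G \<longleftrightarrow> (\<forall>t>0. H1 (\<lambda>x. G x t)) \<and>
     (\<forall>t>0. ((\<lambda>s. H1_dist (\<lambda>x. G x s) (\<lambda>x. G x t)) \<longlongrightarrow> 0) (at t))"

definition L2loc_H1rho :: "(real \<Rightarrow> real \<Rightarrow> real) \<Rightarrow> (real \<Rightarrow> real \<Rightarrow> real) \<Rightarrow> bool" where
  "L2loc_H1rho G Gx \<longleftrightarrow> L2loc_L2 G \<and> L2loc_L2 (\<lambda>x t. sqrt (1 - x^2) * Gx x t) \<and>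
     (AE t in lborel. t > 0 \<longrightarrow> weak_deriv (\<lambda>x. G x t) (\<lambda>x. Gx x t))"

definition pair :: "(real \<Rightarrow> real \<Rightarrow> real) \<Rightarrow> (real \<Rightarrow> real) \<Rightarrow> real \<Rightarrow> real" where
  "pair G v t = (LINT x:Ioo11|lborel. G x t * v x)"

text \<open>partial_t G in L^2_loc((0,infinity); H^{-1}(-1,1)): partial_t G = g0 + partial_x g1
  in the sense of distributions, with g0, g1 in L^2_loc((0,infinity); L^2(-1,1)).\<close>
definition dt_L2loc_Hm1 :: "(real \<Rightarrow> real \<Rightarrow> real) \<Rightarrow> bool" where
  "dt_L2loc_Hm1 G \<longleftrightarrow> (\<exists>g0 g1. L2loc_L2 g0 \<and> L2loc_L2 g1 \<and>
     (\<forall>v w. test_fun_x v \<longrightarrow> test_fun_t w \<longrightarrow>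
        (LINT t|lborel. deriv w t * pair G v t) =
          - (LINT t|lborel. w t * (pair g0 v t - pair g1 (deriv v) t))))"

definition dt_L2loc_L2 :: "(real \<Rightarrow> real \<Rightarrow> real) \<Rightarrow> bool" where
  "dt_L2loc_L2 G \<longleftrightarrow> (\<exists>Gt. L2loc_L2 Gt \<and>
     (\<forall>v w. test_fun_x v \<longrightarrow> test_fun_t w \<longrightarrow>
        (LINT t|lborel. deriv w t * pair G v t) = - (LINT t|lborel. w t * pair Gt v t)))"

text \<open>Weak form of  G_t = (lam/2)(1-x^2) G_xx :  for all test v, chi,
  int chi'(t) (G(t),v) dt = (lam/2) int chi(t) int G_x ((1-x^2) v)' dx dt.\<close>
definition weak_pde :: "real \<Rightarrow> (real \<Rightarrow> real \<Rightarrow> real) \<Rightarrow> (real \<Rightarrow> real \<Rightarrow> real) \<Rightarrow> bool" where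
  "weak_pde lam G Gx \<longleftrightarrow>
     (\<forall>v w. test_fun_x v \<longrightarrow> test_fun_t w \<longrightarrow>
        (LINT t|lborel. deriv w t * pair G v t) =
          lam / 2 * (LINT t|lborel. w t *
             (LINT x:Ioo11|lborel. Gx x t * ((1 - x^2) * deriv v x - 2 * x * v x))))"

definition weak_solution ::
  "real \<Rightarrow> (real \<Rightarrow> real) \<Rightarrow> real \<Rightarrow> (real \<Rightarrow> real \<Rightarrow> real) \<Rightarrow> (real \<Rightarrow> real \<Rightarrow> real) \<Rightarrow> bool" where
  "weak_solution lam G0 p G Gx \<longleftrightarrow>
     C_L2 G \<and> L2loc_H1rho G Gx \<and> dt_L2loc_Hm1 G \<and> weak_pde lam G Gx \<and>
     ((\<lambda>t. L2_dist (\<lambda>x. G x t) G0) \<longlongrightarrow> 0) (at_right 0) \<and>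
     (AE t in lborel. t > 0 \<longrightarrow> trace_at_1 (\<lambda>x. G x t) 1 \<and> trace_at_m1 (\<lambda>x. G x t) p)"

end

theory Submission
  imports Defs "HOL-Computational_Algebra.Polynomial"
begin

text \<open>
  The Jacobi polynomials \<open>\<psi>\<^sub>n\<close> (derivatives of Legendre polynomials, normalised by \<open>\<psi>\<^sub>n(1) = 1\<close>)
  make \<open>\<phi>\<^sub>n = (1 - x\<^sup>2) \<psi>\<^sub>n\<close> eigenfunctions, \<open>(1 - x\<^sup>2) \<phi>\<^sub>n'' = - (n + 1) (n + 2) \<phi>\<^sub>n\<close>, and
  \<open>\<phi>\<^sub>m\<close> is orthogonal to \<open>\<psi>\<^sub>n\<close> for \<open>m \<noteq> n\<close>.  After subtracting the affine function with the
  prescribed boundary values, the solution is the eigenfunction series with coefficients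
  \<open>\<integral>u\<^sub>0 \<psi>\<^sub>n / \<integral>\<phi>\<^sub>n \<psi>\<^sub>n\<close>.  As \<open>\<phi>\<^sub>n\<close>, \<open>\<phi>\<^sub>n'\<close> and \<open>\<psi>\<^sub>n\<close> are bounded by 2 on \<open>[-1, 1]\<close> and
  \<open>\<integral>\<phi>\<^sub>n \<psi>\<^sub>n\<close> is known exactly, the coefficients grow polynomially in the eigenvalue.  Hence the
  series is smooth up to the boundary for \<open>t > 0\<close> and every interior regularity claim holds,
  whatever \<open>u\<^sub>0 \<in> L\<^sup>2\<close> is.

  The initial datum is only in the unweighted \<open>L\<^sup>2\<close>, where the \<open>\<phi>\<^sub>n\<close> are not orthogonal.  Its
  attainment follows instead from the energy identity, which makes the evolution an
  \<open>L\<^sup>2\<close>-contraction, and from the density of \<open>(1 - x\<^sup>2)\<close> times the polynomials.  Continuity in \<open>H\<^sup>1\<close>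
  also needs uniqueness of weak derivatives, because the \<open>H\<^sup>1\<close> distance picks one by choice.
\<close>

section \<open>Square-integrable functions\<close>

definition square_integrable :: "'a measure \<Rightarrow> ('a \<Rightarrow> real) \<Rightarrow> bool" where
  "square_integrable M f \<longleftrightarrow> f \<in> borel_measurable M \<and> integrable M (\<lambda>x. (f x)\<^sup>2)"

definition l2_norm :: "'a measure \<Rightarrow> ('a \<Rightarrow> real) \<Rightarrow> real" where
  "l2_norm M f = sqrt (LINT x|M. (f x)\<^sup>2)"

lemma square_integrable_measurable: "square_integrable M f \<Longrightarrow> f \<in> borel_measurable M"
  by (simp add: square_integrable_def)

lemma square_integrable_mult:
  assumes "square_integrable M f" "square_integrable M g"
  shows "integrable M (\<lambda>x. f x * g x)"
proof (rule Bochner_Integration.integrable_bound)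
  show "integrable M (\<lambda>x. (f x)\<^sup>2 + (g x)\<^sup>2)"
    using assms by (simp add: square_integrable_def)
  have "\<bar>y * z\<bar> \<le> y\<^sup>2 + z\<^sup>2" for y z :: real
    using sum_squares_bound[of "\<bar>y\<bar>" "\<bar>z\<bar>"] mult_nonneg_nonneg[of "\<bar>y\<bar>" "\<bar>z\<bar>"]
    unfolding abs_mult power2_abs by linarith
  then show "AE x in M. norm (f x * g x) \<le> norm ((f x)\<^sup>2 + (g x)\<^sup>2)"
    by (intro AE_I2) simp
qed (intro borel_measurable_times square_integrable_measurable assms)

lemma square_integrable_add:
  assumes "square_integrable M f" "square_integrable M g"
  shows "square_integrable M (\<lambda>x. f x + g x)"
  using assms square_integrable_mult[OF assms]
  by (simp add: square_integrable_def power2_sum mult.assoc borel_measurable_add)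

lemma square_integrable_cmult: "square_integrable M f \<Longrightarrow> square_integrable M (\<lambda>x. c * f x)"
  by (simp add: square_integrable_def power_mult_distrib borel_measurable_times)

lemma square_integrable_diff:
  "square_integrable M f \<Longrightarrow> square_integrable M g \<Longrightarrow> square_integrable M (\<lambda>x. f x - g x)"
  using square_integrable_add[of M f "\<lambda>x. (-1) * g x"] square_integrable_cmult[of M g "-1"] by simp

lemma square_integrable_bound:
  assumes "square_integrable M g" "f \<in> borel_measurable M" "\<And>x. x \<in> space M \<Longrightarrow> \<bar>f x\<bar> \<le> \<bar>g x\<bar>"
  shows "square_integrable M f"
proof -
  have "integrable M (\<lambda>x. (f x)\<^sup>2)"
    by (rule Bochner_Integration.integrable_bound[of _ "\<lambda>x. (g x)\<^sup>2"])
       (use assms in \<open>auto simp: square_integrable_def abs_le_square_iff\<close>)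
  then show ?thesis
    using assms(2) by (simp add: square_integrable_def)
qed

lemma l2_norm_nonneg: "l2_norm M f \<ge> 0"
  by (simp add: l2_norm_def)

lemma l2_norm_square: "(l2_norm M f)\<^sup>2 = (LINT x|M. (f x)\<^sup>2)"
  by (simp add: l2_norm_def)

lemma l2_norm_cong: "(\<And>x. x \<in> space M \<Longrightarrow> f x = g x) \<Longrightarrow> l2_norm M f = l2_norm M g"
  unfolding l2_norm_def by (intro arg_cong[of _ _ sqrt] Bochner_Integration.integral_cong) auto

lemma nn_integral_square_eq_l2_norm:
  assumes "square_integrable M f"
  shows "(\<integral>\<^sup>+x. (ennreal \<bar>f x\<bar>)\<^sup>2 \<partial>M) = ennreal ((l2_norm M f)\<^sup>2)"
proof -
  have "(\<integral>\<^sup>+x. (ennreal \<bar>f x\<bar>)\<^sup>2 \<partial>M) = (\<integral>\<^sup>+x. ennreal ((f x)\<^sup>2) \<partial>M)"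
    by (intro nn_integral_cong) (simp add: ennreal_power)
  also have "\<dots> = ennreal ((l2_norm M f)\<^sup>2)"
    unfolding l2_norm_square
    using assms by (intro nn_integral_eq_integral) (auto simp: square_integrable_def)
  finally show ?thesis .
qed

lemma Cauchy_Schwarz_integral:
  assumes "square_integrable M f" "square_integrable M g"
  shows "\<bar>LINT x|M. f x * g x\<bar> \<le> l2_norm M f * l2_norm M g"
proof -
  define I where "I = (LINT x|M. \<bar>f x * g x\<bar>)"
  have "ennreal I = (\<integral>\<^sup>+x. ennreal \<bar>f x * g x\<bar> \<partial>M)"
    unfolding I_def
    by (intro nn_integral_eq_integral[symmetric] integrable_abs square_integrable_mult assms) simp
  then have "ennreal (I\<^sup>2) = (\<integral>\<^sup>+x. ennreal \<bar>f x\<bar> * ennreal \<bar>g x\<bar> \<partial>M)\<^sup>2"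
    by (simp add: I_def abs_mult ennreal_mult flip: ennreal_power)
  also have "\<dots> \<le> (\<integral>\<^sup>+x. ennreal \<bar>f x\<bar> ^ 2 \<partial>M) * (\<integral>\<^sup>+x. ennreal \<bar>g x\<bar> ^ 2 \<partial>M)"
    using assms[THEN square_integrable_measurable] by (intro Cauchy_Schwarz_nn_integral) simp_all
  also have "\<dots> = ennreal ((l2_norm M f * l2_norm M g)\<^sup>2)"
    unfolding nn_integral_square_eq_l2_norm[OF assms(1)] nn_integral_square_eq_l2_norm[OF assms(2)]
    by (simp add: ennreal_mult power_mult_distrib)
  finally have "I\<^sup>2 \<le> (l2_norm M f * l2_norm M g)\<^sup>2"
    by simp
  then have "I \<le> l2_norm M f * l2_norm M g"
    by (rule power2_le_imp_le) (simp add: l2_norm_nonneg)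
  moreover have "\<bar>LINT x|M. f x * g x\<bar> \<le> I"
    unfolding I_def using integral_norm_bound[of M "\<lambda>x. f x * g x"] by simp
  ultimately show ?thesis by simp
qed

lemma l2_norm_triangle:
  assumes f: "square_integrable M f" and g: "square_integrable M g"
  shows "l2_norm M (\<lambda>x. f x + g x) \<le> l2_norm M f + l2_norm M g"
proof (rule power2_le_imp_le)
  have "(l2_norm M (\<lambda>x. f x + g x))\<^sup>2 = (l2_norm M f)\<^sup>2 + (l2_norm M g)\<^sup>2 + 2 * (LINT x|M. f x * g x)"
    using f g square_integrable_mult[OF f g]
    by (simp add: l2_norm_square power2_sum square_integrable_def mult.assoc)
  also have "\<dots> \<le> (l2_norm M f + l2_norm M g)\<^sup>2"
    using Cauchy_Schwarz_integral[OF f g] by (simp add: power2_sum)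
  finally show "(l2_norm M (\<lambda>x. f x + g x))\<^sup>2 \<le> (l2_norm M f + l2_norm M g)\<^sup>2" .
qed (simp add: l2_norm_nonneg)

lemma (in finite_measure) square_integrable_bounded:
  assumes "f \<in> borel_measurable M" "\<And>x. x \<in> space M \<Longrightarrow> \<bar>f x\<bar> \<le> B"
  shows "square_integrable M f"
proof (rule square_integrable_bound)
  show "square_integrable M (\<lambda>_. B)"
    by (simp add: square_integrable_def)
  show "\<bar>f x\<bar> \<le> \<bar>B\<bar>" if "x \<in> space M" for x
    using assms(2)[OF that] by simp
qed (rule assms(1))

lemma (in finite_measure) l2_norm_bounded:
  assumes "f \<in> borel_measurable M" "\<And>x. x \<in> space M \<Longrightarrow> \<bar>f x\<bar> \<le> B" "B \<ge> 0"
  shows "l2_norm M f \<le> sqrt (measure M (space M)) * B"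
proof -
  have "(LINT x|M. (f x)\<^sup>2) \<le> (LINT x|M. B\<^sup>2)"
  proof (rule integral_mono)
    show "(f x)\<^sup>2 \<le> B\<^sup>2" if "x \<in> space M" for x
      using assms(2)[OF that] abs_le_square_iff[of "f x" B] assms(3) by simp
  qed (use square_integrable_bounded[OF assms(1,2)] in \<open>auto simp: square_integrable_def\<close>)
  then have "l2_norm M f \<le> sqrt (measure M (space M) * B\<^sup>2)"
    unfolding l2_norm_def by (intro real_sqrt_le_mono) simp
  then show ?thesis
    using assms(3) by (simp add: real_sqrt_mult)
qed

lemma l2_norm_tendsto_zero:
  assumes f: "\<And>n. f n \<in> borel_measurable M" and w: "square_integrable M w"
    and lim: "AE x in M. (\<lambda>n. f n x) \<longlonglongrightarrow> 0"
    and bound: "\<And>n x. x \<in> space M \<Longrightarrow> \<bar>f n x\<bar> \<le> \<bar>w x\<bar>"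
  shows "(\<lambda>n. l2_norm M (f n)) \<longlonglongrightarrow> 0"
proof -
  have "(\<lambda>n. LINT x|M. (f n x)\<^sup>2) \<longlonglongrightarrow> (LINT x|M. 0)"
  proof (rule integral_dominated_convergence[where w = "\<lambda>x. (w x)\<^sup>2"])
    show "AE x in M. (\<lambda>n. (f n x)\<^sup>2) \<longlonglongrightarrow> 0"
      using lim
    proof eventually_elim
      case (elim x)
      then show ?case using tendsto_power[OF elim, of 2] by simp
    qed
    show "AE x in M. norm ((f n x)\<^sup>2) \<le> (w x)\<^sup>2" for n
      using bound by (intro AE_I2) (simp add: abs_le_square_iff)
  qed (use f w in \<open>auto simp: square_integrable_def\<close>)
  then have "(\<lambda>n. sqrt (LINT x|M. (f n x)\<^sup>2)) \<longlonglongrightarrow> sqrt 0"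
    by (intro tendsto_real_sqrt) simp
  then show ?thesis by (simp add: l2_norm_def)
qed

section \<open>The space \<open>L\<^sup>2(-1, 1)\<close>\<close>

abbreviation lborel11 :: "real measure" where
  "lborel11 \<equiv> restrict_space lborel Ioo11"

interpretation lborel11: finite_measure lborel11
  by standard (simp add: emeasure_restrict_space)


lemma LINT_lborel11: "(LINT x:Ioo11|lborel. f x) = (LINT x|lborel11. f x)" for f :: "real \<Rightarrow> real"
  by (simp add: set_lebesgue_integral_def integral_restrict_space)

lemma set_borel_measurable_lborel11:
  "set_borel_measurable lborel Ioo11 f \<longleftrightarrow> f \<in> borel_measurable lborel11" for f :: "real \<Rightarrow> real"
  by (simp add: set_borel_measurable_def borel_measurable_restrict_space_iff)

lemma L2_iff_square_integrable: "L2 f \<longleftrightarrow> square_integrable lborel11 f"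
  by (simp add: L2_def square_integrable_def set_borel_measurable_lborel11 set_integrable_eq)

lemma L2_measurable: "L2 f \<Longrightarrow> f \<in> borel_measurable lborel11"
  by (simp add: L2_iff_square_integrable square_integrable_measurable)

lemma L2_diff: "L2 f \<Longrightarrow> L2 g \<Longrightarrow> L2 (\<lambda>x. f x - g x)"
  by (simp add: L2_iff_square_integrable square_integrable_diff)

abbreviation L2_norm :: "(real \<Rightarrow> real) \<Rightarrow> real" where
  "L2_norm \<equiv> l2_norm lborel11"

lemma L2_norm_triangle: "L2 f \<Longrightarrow> L2 g \<Longrightarrow> L2_norm (\<lambda>x. f x + g x) \<le> L2_norm f + L2_norm g"
  by (simp add: L2_iff_square_integrable l2_norm_triangle)

lemma L2_norm_bounded:
  assumes "L2 f" "\<And>x. x \<in> Ioo11 \<Longrightarrow> \<bar>f x\<bar> \<le> B" "B \<ge> 0"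
  shows "L2_norm f \<le> sqrt 2 * B"
  using lborel11.l2_norm_bounded[OF L2_measurable[OF assms(1)] _ assms(3)] assms(2)
  by (simp add: measure_restrict_space)

lemma L2_dist_eq_L2_norm: "L2_dist f g = L2_norm (\<lambda>x. f x - g x)"
  by (simp add: L2_dist_def l2_norm_def LINT_lborel11)

lemma set_integrable_Ioo_continuous:
  fixes f :: "real \<Rightarrow> real"
  assumes "continuous_on {a..b} f"
  shows "set_integrable lborel {a<..<b} f"
  by (rule set_integrable_subset[OF borel_integrable_atLeastAtMost'[OF assms]]) auto

lemma LINT_Ioo_continuous:
  fixes f :: "real \<Rightarrow> real"
  assumes "continuous_on {a..b} f"
  shows "(LINT x:{a<..<b}|lborel. f x) = integral {a..b} f"
  using set_borel_integral_eq_integral(2)[OF set_integrable_Ioo_continuous[OF assms]]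
  by (simp add: integral_open_interval_real)

lemma L2_continuous:
  assumes "continuous_on {-1..1} f"
  shows "L2 f"
proof -
  have "set_integrable lborel Ioo11 f" "set_integrable lborel Ioo11 (\<lambda>x. (f x)\<^sup>2)"
    using assms by (auto intro!: set_integrable_Ioo_continuous continuous_intros)
  then show ?thesis
    unfolding L2_def by (auto simp: set_integrable_def set_borel_measurable_def)
qed

lemma L2_dist_continuous:
  assumes "continuous_on {-1..1} f" "continuous_on {-1..1} g"
  shows "L2_dist f g = sqrt (integral {-1..1} (\<lambda>x. (f x - g x)\<^sup>2))"
  unfolding L2_dist_def using assms by (subst LINT_Ioo_continuous) (auto intro!: continuous_intros)

lemma L2_dist_nonneg: "L2_dist f g \<ge> 0"
  by (simp add: L2_dist_eq_L2_norm l2_norm_nonneg)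

lemma L2_dist_commute: "L2_dist f g = L2_dist g f"
  by (simp add: L2_dist_def power2_commute)

lemma L2_dist_cong: "(\<And>x. x \<in> Ioo11 \<Longrightarrow> f x - g x = f' x - g' x) \<Longrightarrow> L2_dist f g = L2_dist f' g'"
  unfolding L2_dist_eq_L2_norm by (intro l2_norm_cong) simp

lemma L2_dist_triangle:
  assumes "L2 f" "L2 g" "L2 h"
  shows "L2_dist f h \<le> L2_dist f g + L2_dist g h"
  using L2_norm_triangle[of "\<lambda>x. f x - g x" "\<lambda>x. g x - h x"] assms
  by (simp add: L2_dist_eq_L2_norm L2_diff)

section \<open>Smooth functions\<close>

lemma smooth_fun_coinduct:
  assumes "f \<in> S" and "\<And>g. g \<in> S \<Longrightarrow> \<exists>g'\<in>S. \<forall>x. (g has_real_derivative g' x) (at x)"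
  shows "smooth_fun f"
proof -
  have "(deriv ^^ n) f \<in> S" for n
  proof (induction n)
    case (Suc n)
    from assms(2)[OF this] obtain g'
      where g': "g' \<in> S" "\<forall>x. ((deriv ^^ n) f has_real_derivative g' x) (at x)" by blast
    then have "deriv ((deriv ^^ n) f) = g'"
      by (intro ext DERIV_imp_deriv) auto
    with g'(1) show ?case by simp
  qed (use assms(1) in simp)
  then show ?thesis
    unfolding smooth_fun_def using assms(2) real_differentiable_def by blast
qed

lemma smooth_fun_DERIV: "smooth_fun f \<Longrightarrow> (f has_real_derivative deriv f x) (at x)"
  unfolding smooth_fun_def using DERIV_deriv_iff_real_differentiable by (metis funpow_0)

lemma smooth_fun_deriv: "smooth_fun f \<Longrightarrow> smooth_fun (deriv f)"
  unfolding smooth_fun_def by (metis funpow_Suc_right comp_apply)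

lemma smooth_fun_continuous: "smooth_fun f \<Longrightarrow> continuous_on A f"
  by (meson smooth_fun_DERIV DERIV_continuous continuous_at_imp_continuous_on)

lemma smooth_fun_continuous_deriv: "smooth_fun f \<Longrightarrow> continuous_on A (deriv f)"
  by (intro smooth_fun_continuous smooth_fun_deriv)

lemma smooth_fun_measurable: "smooth_fun f \<Longrightarrow> f \<in> borel_measurable borel"
  by (intro borel_measurable_continuous_onI smooth_fun_continuous)

lemma smooth_fun_affine:
  assumes "smooth_fun f"
  shows "smooth_fun (\<lambda>x. f (c * x + d))"
proof (rule smooth_fun_coinduct[where S = "{\<lambda>x. k * g (c * x + d) | k g. smooth_fun g}"])
  show "(\<lambda>x. f (c * x + d)) \<in> {\<lambda>x. k * g (c * x + d) | k g. smooth_fun g}"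
    using assms by (intro CollectI exI[of _ 1] exI[of _ f]) simp
next
  fix h assume "h \<in> {\<lambda>x. k * g (c * x + d) | k g. smooth_fun g}"
  then obtain k g where h: "h = (\<lambda>x. k * g (c * x + d))" and g: "smooth_fun g" by blast
  have "(h has_real_derivative (k * c) * deriv g (c * x + d)) (at x)" for x
    unfolding h by (auto intro!: derivative_eq_intros DERIV_chain2[OF smooth_fun_DERIV[OF g]])
  with smooth_fun_deriv[OF g]
  show "\<exists>h'\<in>{\<lambda>x. k * g (c * x + d) | k g. smooth_fun g}. \<forall>x. (h has_real_derivative h' x) (at x)"
    by (intro bexI[of _ "\<lambda>x. (k * c) * deriv g (c * x + d)"]) auto
qed

inductive_set smooth_product_sums :: "(real \<Rightarrow> real) set" where
  mult: "smooth_fun f \<Longrightarrow> smooth_fun g \<Longrightarrow> (\<lambda>x. f x * g x) \<in> smooth_product_sums"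
| add: "F \<in> smooth_product_sums \<Longrightarrow> G \<in> smooth_product_sums \<Longrightarrow> (\<lambda>x. F x + G x) \<in> smooth_product_sums"

lemma smooth_fun_mult:
  assumes "smooth_fun f" "smooth_fun g"
  shows "smooth_fun (\<lambda>x. f x * g x)"
proof (rule smooth_fun_coinduct[where S = smooth_product_sums])
  show "(\<lambda>x. f x * g x) \<in> smooth_product_sums"
    using assms by (rule smooth_product_sums.mult)
  show "\<exists>F'\<in>smooth_product_sums. \<forall>x. (F has_real_derivative F' x) (at x)"
    if "F \<in> smooth_product_sums" for F
    using that
  proof induction
    case (mult f g)
    then show ?case
      by (intro bexI[of _ "\<lambda>x. deriv f x * g x + deriv g x * f x"] allI DERIV_mult smooth_fun_DERIV
          smooth_product_sums.intros smooth_fun_deriv)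
  next
    case (add F G)
    then obtain F' G' where "F' \<in> smooth_product_sums" "G' \<in> smooth_product_sums"
      "\<forall>x. (F has_real_derivative F' x) (at x)" "\<forall>x. (G has_real_derivative G' x) (at x)"
      by blast
    then show ?case
      by (intro bexI[of _ "\<lambda>x. F' x + G' x"] allI DERIV_add smooth_product_sums.add) auto
  qed
qed

definition flat_exp :: "real poly \<Rightarrow> real \<Rightarrow> real" where
  "flat_exp p x = (if x > 0 then poly p (1 / x) * exp (- (1 / x)) else 0)"

lemma poly_over_exp_tendsto_0: "((\<lambda>x. poly p x / exp x) \<longlongrightarrow> 0) at_top" for p :: "real poly"
proof -
  have "((\<lambda>x. \<Sum>i\<le>degree p. coeff p i * (x ^ i / exp x)) \<longlongrightarrow> (\<Sum>i\<le>degree p. coeff p i * 0)) at_top"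
    by (intro tendsto_intros tendsto_power_div_exp_0)
  then show ?thesis
    by (simp add: poly_altdef sum_divide_distrib)
qed

lemma flat_exp_DERIV:
  "(flat_exp p has_real_derivative flat_exp ([:0, 0, 1:] * (p - pderiv p)) x) (at x)"
proof -
  let ?q = "[:0, 0, 1:] * (p - pderiv p)"
  consider (pos) "x > 0" | (neg) "x < 0" | (zero) "x = 0" by linarith
  then show ?thesis
  proof cases
    case pos
    then have "((\<lambda>x. poly p (1 / x) * exp (- (1 / x))) has_real_derivative flat_exp ?q x) (at x)"
      by (auto intro!: derivative_eq_intros DERIV_chain2[OF poly_DERIV]
          simp: flat_exp_def field_simps power2_eq_square)
    then show ?thesis
      by (rule has_field_derivative_transform_within_open[of _ _ _ "{0<..}"])
         (use pos in \<open>auto simp: flat_exp_def\<close>)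
  next
    case neg
    then have "((\<lambda>x. 0) has_real_derivative flat_exp ?q x) (at x)"
      by (simp add: flat_exp_def)
    then show ?thesis
      by (rule has_field_derivative_transform_within_open[of _ _ _ "{..<0}"])
         (use neg in \<open>auto simp: flat_exp_def\<close>)
  next
    case zero
    have "((\<lambda>h. poly (pCons 0 p) (inverse h) / exp (inverse h)) \<longlongrightarrow> 0) (at_right 0)"
      by (rule filterlim_compose[OF poly_over_exp_tendsto_0 filterlim_inverse_at_top_right])
    moreover have "\<forall>\<^sub>F h in at_right 0.
        poly (pCons 0 p) (inverse h) / exp (inverse h) = flat_exp p h / h"
      using eventually_at_right_less
      by eventually_elim (simp add: flat_exp_def exp_minus field_simps)
    ultimately have "((\<lambda>h. flat_exp p h / h) \<longlongrightarrow> 0) (at_right 0)"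
      by (rule Lim_transform_eventually)
    moreover have "((\<lambda>h. flat_exp p h / h) \<longlongrightarrow> 0) (at_left 0)"
      by (rule tendsto_eventually) (auto simp: flat_exp_def eventually_at_filter)
    ultimately have "((\<lambda>h. flat_exp p h / h) \<longlongrightarrow> 0) (at 0)"
      by (simp add: filterlim_at_split)
    then show ?thesis
      by (simp add: zero has_field_derivative_iff flat_exp_def[of _ 0])
  qed
qed

lemma smooth_fun_flat_exp: "smooth_fun (flat_exp p)"
  by (rule smooth_fun_coinduct[where S = "range flat_exp"]) (use flat_exp_DERIV in blast)+

definition bump :: "real \<Rightarrow> real \<Rightarrow> real \<Rightarrow> real \<Rightarrow> real" where
  "bump a b k x = flat_exp 1 (k * (x - a)) * flat_exp 1 (k * (b - x))"

lemma smooth_fun_bump: "smooth_fun (bump a b k)"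
proof -
  have "smooth_fun (\<lambda>x. flat_exp 1 (k * x + - (k * a)) * flat_exp 1 (- k * x + k * b))"
    by (intro smooth_fun_mult smooth_fun_affine smooth_fun_flat_exp)
  then show ?thesis
    by (simp add: bump_def[abs_def] algebra_simps)
qed

lemma bump_nonzeroD: "bump a b k x \<noteq> 0 \<Longrightarrow> k \<ge> 0 \<Longrightarrow> a < x \<and> x < b"
  by (auto simp: bump_def flat_exp_def zero_less_mult_iff split: if_splits)

lemma abs_bump_le_1: "\<bar>bump a b k x\<bar> \<le> 1"
  unfolding bump_def abs_mult by (rule mult_le_one) (auto simp: flat_exp_def)

lemma bump_tendsto_indicator: "(\<lambda>n. bump a b (real (Suc n)) x) \<longlonglongrightarrow> indicator {a<..<b} x"
proof (cases "x \<in> {a<..<b}")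
  case True
  have flat_exp_tendsto_1: "(\<lambda>n. flat_exp 1 (real (Suc n) * y)) \<longlonglongrightarrow> 1" if "y > 0" for y
  proof -
    have "(\<lambda>n. exp (- (1 / real (Suc n) * (1 / y)))) \<longlonglongrightarrow> exp (- (0 * (1 / y)))"
      by (intro tendsto_intros LIMSEQ_Suc[OF lim_1_over_n])
    then show ?thesis using that by (simp add: flat_exp_def)
  qed
  have "(\<lambda>n. bump a b (real (Suc n)) x) \<longlonglongrightarrow> 1 * 1"
    unfolding bump_def using True by (intro tendsto_mult flat_exp_tendsto_1) auto
  then show ?thesis using True by simp
next
  case False
  then have "bump a b (real (Suc n)) x = 0" for n
    using bump_nonzeroD[of a b "real (Suc n)" x] by auto
  then show ?thesis using False by simp
qed

lemma test_fun_x_bump: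
  assumes "k \<ge> 0" "-1 < a" "b < 1"
  shows "test_fun_x (bump a b k)"
  unfolding test_fun_x_def
proof (intro conjI exI)
  show "\<forall>x. x \<notin> {a..b} \<longrightarrow> bump a b k x = 0"
    using bump_nonzeroD[of a b k] assms(1) by fastforce
qed (use assms smooth_fun_bump in auto)

lemma test_fun_x_smooth: "test_fun_x v \<Longrightarrow> smooth_fun v"
  by (simp add: test_fun_x_def)

section \<open>Uniqueness of weak derivatives\<close>

lemma LINT_mult_bounded_tendsto:
  fixes f h :: "'a \<Rightarrow> real"
  assumes f: "integrable M f"
    and meas: "\<And>n. g n \<in> borel_measurable M"
    and bound: "\<And>n x. \<bar>g n x\<bar> \<le> B"
    and lim: "\<And>x. (\<lambda>n. g n x) \<longlonglongrightarrow> h x"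
  shows "(\<lambda>n. LINT x|M. f x * g n x) \<longlonglongrightarrow> (LINT x|M. f x * h x)"
proof (rule integral_dominated_convergence)
  have [measurable]: "f \<in> borel_measurable M" using f by auto
  note meas[measurable]
  have [measurable]: "h \<in> borel_measurable M"
    by (rule borel_measurable_LIMSEQ_real[OF lim meas])
  show "(\<lambda>x. f x * h x) \<in> borel_measurable M" by measurable
  show "(\<lambda>x. f x * g n x) \<in> borel_measurable M" for n by measurable
  show "AE x in M. norm (f x * g n x) \<le> \<bar>f x\<bar> * B" for n
    using bound by (intro AE_I2) (auto simp: abs_mult intro: mult_left_mono)
qed (use f lim in \<open>auto intro!: tendsto_intros\<close>)

lemma LINT_Ioo_eq_0_of_test_fun:
  assumes loc: "loc_int g"
    and zero: "\<And>\<phi>. test_fun_x \<phi> \<Longrightarrow> (LINT x:Ioo11|lborel. g x * \<phi> x) = 0"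
    and ab: "-1 < a" "b < 1"
  shows "(LINT x:{a<..<b}|lborel. g x) = 0"
proof -
  have "integrable lborel (\<lambda>x. indicator {a..b} x * g x)"
    using loc ab unfolding loc_int_def set_integrable_def by simp
  then have "(\<lambda>n. LINT x|lborel. (indicator {a..b} x * g x) * bump a b (real (Suc n)) x)
      \<longlonglongrightarrow> (LINT x|lborel. (indicator {a..b} x * g x) * indicator {a<..<b} x)"
    using smooth_fun_measurable[OF smooth_fun_bump]
    by (intro LINT_mult_bounded_tendsto[where B = 1] bump_tendsto_indicator)
       (auto simp: abs_bump_le_1)
  also have "(\<lambda>n. LINT x|lborel. (indicator {a..b} x * g x) * bump a b (real (Suc n)) x)
      = (\<lambda>n. LINT x:Ioo11|lborel. g x * bump a b (real (Suc n)) x)"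
    unfolding set_lebesgue_integral_def using ab
    by (intro ext Bochner_Integration.integral_cong) (auto simp: indicator_def dest: bump_nonzeroD)
  also have "\<dots> = (\<lambda>n. 0)"
    using ab by (intro ext zero test_fun_x_bump) auto
  also have "(LINT x|lborel. (indicator {a..b} x * g x) * indicator {a<..<b} x)
      = (LINT x:{a<..<b}|lborel. g x)"
    unfolding set_lebesgue_integral_def
    by (intro Bochner_Integration.integral_cong) (auto simp: indicator_def)
  finally show ?thesis by (simp add: LIMSEQ_const_iff)
qed

lemma AE_zero_of_interval_integrals:
  fixes f :: "real \<Rightarrow> real"
  assumes int: "set_integrable lborel {c..d} f"
    and zero: "\<And>a b. c \<le> a \<Longrightarrow> b \<le> d \<Longrightarrow> (LINT x:{a<..<b}|lborel. f x) = 0"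
  shows "AE x in lborel. x \<in> {c<..<d} \<longrightarrow> f x = 0"
proof -
  let ?f = "\<lambda>x. indicator {c..d} x *\<^sub>R f x"
  have "?f integrable_on cbox a b" for a b
    using int integrable_on_lborel integrable_on_subcbox unfolding set_integrable_def by blast
  then obtain N where N: "negligible N"
    and diff: "\<And>x e. \<lbrakk>x \<notin> N; 0 < e\<rbrakk> \<Longrightarrow> \<exists>\<delta>>0. \<forall>h. 0 < h \<and> h < \<delta> \<longrightarrow>
       norm (integral (cbox x (x + h *\<^sub>R One)) ?f /\<^sub>R h ^ DIM(real) - ?f x) < e"
    using integrable_ccontinuous_explicit[of ?f] by blast
  have "f x = 0" if x: "x \<in> {c<..<d}" "x \<notin> N" for x
  proof (rule ccontr)
    assume "f x \<noteq> 0"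
    then obtain \<delta> where \<delta>: "\<delta> > 0"
      and close: "\<And>h. 0 < h \<Longrightarrow> h < \<delta> \<Longrightarrow> \<bar>integral {x..x + h} ?f / h - f x\<bar> < \<bar>f x\<bar>"
      using diff[OF x(2), of "\<bar>f x\<bar>"] x(1) by (auto simp: divide_inverse mult.commute)
    define h where "h = min (\<delta> / 2) ((d - x) / 2)"
    have h: "0 < h" "h < \<delta>" "x + h \<le> d"
      using \<delta> x(1) by (auto simp: h_def min_def field_simps)
    have "integral {x..x + h} ?f = integral {x<..<x + h} f"
      unfolding integral_open_interval_real
      using h x(1) by (intro integral_cong) auto
    also have "\<dots> = (LINT y:{x<..<x + h}|lborel. f y)"
      using h x(1)
      by (intro set_borel_integral_eq_integral(2)[symmetric] set_integrable_subset[OF int]) auto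
    also have "\<dots> = 0"
      using h x(1) by (intro zero) auto
    finally show False using close[OF h(1,2)] by simp
  qed
  then have "{x. \<not> (x \<in> {c<..<d} \<longrightarrow> f x = 0)} \<subseteq> N" by blast
  then have "AE x in lebesgue. x \<in> {c<..<d} \<longrightarrow> f x = 0"
    using N by (auto simp: negligible_iff_null_sets intro: AE_I'[of N])
  then show ?thesis by (simp add: AE_completion_iff)
qed

lemma eventually_in_exhaustion_Ioo11:
  assumes "x \<in> Ioo11"
  shows "\<forall>\<^sub>F n in sequentially. x \<in> {- (real n / real (Suc n))<..<real n / real (Suc n)}"
proof -
  have "\<forall>\<^sub>F n in sequentially. \<bar>x\<bar> < real n / real (Suc n)"
    using assms by (intro order_tendstoD(1)[OF LIMSEQ_n_over_Suc_n]) auto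
  then show ?thesis
    by eventually_elim auto
qed

lemma AE_zero_of_test_fun:
  assumes "loc_int g"
    and "\<And>\<phi>. test_fun_x \<phi> \<Longrightarrow> (LINT x:Ioo11|lborel. g x * \<phi> x) = 0"
  shows "AE x in lborel. x \<in> Ioo11 \<longrightarrow> g x = 0"
proof -
  have "AE x in lborel. x \<in> {- (real n / real (Suc n))<..<real n / real (Suc n)} \<longrightarrow> g x = 0" for n
  proof (rule AE_zero_of_interval_integrals)
    show "set_integrable lborel {- (real n / real (Suc n))..real n / real (Suc n)} g"
      using assms(1) unfolding loc_int_def by (simp add: field_simps)
    show "(LINT x:{a<..<b}|lborel. g x) = 0"
      if "- (real n / real (Suc n)) \<le> a" "b \<le> real n / real (Suc n)" for a b
    proof (rule LINT_Ioo_eq_0_of_test_fun[OF assms])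
      have "real n / real (Suc n) < 1" by simp
      then show "-1 < a" "b < 1" using that by linarith+
    qed
  qed
  then have "AE x in lborel. \<forall>n. x \<in> {- (real n / real (Suc n))<..<real n / real (Suc n)} \<longrightarrow> g x = 0"
    unfolding AE_all_countable by blast
  then show ?thesis
    by eventually_elim (use eventually_in_exhaustion_Ioo11 eventually_happens in \<open>fastforce\<close>)
qed

lemma loc_int_measurable:
  assumes "loc_int g"
  shows "set_borel_measurable lborel Ioo11 g"
  unfolding set_borel_measurable_def
proof (rule borel_measurable_LIMSEQ_real)
  let ?I = "\<lambda>n. {- (real n / real (Suc n))..real n / real (Suc n)}"
  show "(\<lambda>x. indicator (?I n) x *\<^sub>R g x) \<in> borel_measurable lborel" for n
  proof -
    have "set_integrable lborel (?I n) g"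
      using assms unfolding loc_int_def by (simp add: field_simps)
    then show ?thesis unfolding set_integrable_def by auto
  qed
  show "(\<lambda>n. indicator (?I n) x *\<^sub>R g x) \<longlonglongrightarrow> indicator Ioo11 x *\<^sub>R g x" for x
  proof (cases "x \<in> Ioo11")
    case True
    from eventually_in_exhaustion_Ioo11[OF this]
    have "\<forall>\<^sub>F n in sequentially. indicator (?I n) x *\<^sub>R g x = indicator Ioo11 x *\<^sub>R g x"
      by eventually_elim (use True in auto)
    then show ?thesis by (rule tendsto_eventually)
  next
    case False
    have "x \<notin> ?I n" for n
    proof -
      have "real n / real (Suc n) < 1" by simp
      with False show ?thesis unfolding atLeastAtMost_iff greaterThanLessThan_iff by linarith
    qed
    with False show ?thesis by simp
  qed
qed

lemma set_integrable_mult_test_fun: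
  assumes g: "loc_int g" and \<phi>: "test_fun_x \<phi>"
  shows "set_integrable lborel Ioo11 (\<lambda>x. g x * \<phi> x)"
proof -
  obtain a b where ab: "-1 < a" "b < 1" "\<And>x. x \<notin> {a..b} \<Longrightarrow> \<phi> x = 0"
    using \<phi> unfolding test_fun_x_def by blast
  have "bounded (\<phi> ` {a..b})"
    by (intro compact_imp_bounded compact_continuous_image smooth_fun_continuous
        test_fun_x_smooth \<phi>) auto
  then obtain B where B: "\<And>x. x \<in> {a..b} \<Longrightarrow> \<bar>\<phi> x\<bar> \<le> B"
    unfolding bounded_iff by (metis imageI real_norm_def)
  have int: "set_integrable lborel {a..b} g"
    using g ab by (simp add: loc_int_def)
  then have "set_integrable lborel {a..b} (\<lambda>x. B * g x)" by simp
  then have "set_integrable lborel {a..b} (\<lambda>x. g x * \<phi> x)"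
  proof (rule set_integrable_bound)
    have "(\<lambda>x. (indicator {a..b} x *\<^sub>R g x) * \<phi> x) \<in> borel_measurable lborel"
      using int smooth_fun_measurable[OF test_fun_x_smooth[OF \<phi>]] unfolding set_integrable_def
      by (intro borel_measurable_times) auto
    then show "set_borel_measurable lborel {a..b} (\<lambda>x. g x * \<phi> x)"
      by (simp add: set_borel_measurable_def mult.assoc)
    show "AE x in lborel. x \<in> {a..b} \<longrightarrow> norm (g x * \<phi> x) \<le> norm (B * g x)"
      using B by (intro AE_I2)
        (auto simp: abs_mult mult.commute intro!: mult_right_mono
          intro: order_trans[OF _ abs_ge_self])
  qed
  also have "set_integrable lborel {a..b} (\<lambda>x. g x * \<phi> x)
      = set_integrable lborel Ioo11 (\<lambda>x. g x * \<phi> x)"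
    unfolding set_integrable_def using ab
    by (intro Bochner_Integration.integrable_cong) (auto simp: indicator_def)
  finally show ?thesis .
qed

lemma weak_deriv_unique:
  assumes "weak_deriv f g" "weak_deriv f h"
  shows "AE x in lborel. x \<in> Ioo11 \<longrightarrow> g x = h x"
proof -
  have loc: "loc_int g" "loc_int h"
    using assms by (auto simp: weak_deriv_def)
  have "AE x in lborel. x \<in> Ioo11 \<longrightarrow> g x - h x = 0"
  proof (rule AE_zero_of_test_fun)
    show "loc_int (\<lambda>x. g x - h x)"
      using loc by (auto simp: loc_int_def intro: set_integral_diff)
    show "(LINT x:Ioo11|lborel. (g x - h x) * \<phi> x) = 0" if \<phi>: "test_fun_x \<phi>" for \<phi>
      using loc[THEN set_integrable_mult_test_fun[OF _ \<phi>]] assms \<phi>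
      by (simp add: weak_deriv_def left_diff_distrib)
  qed
  then show ?thesis by simp
qed

section \<open>Classical solutions are weak solutions\<close>

lemma continuous_compact_support_integral:
  fixes h :: "real \<Rightarrow> real"
  assumes "continuous_on {a..b} h" "\<And>x. x \<notin> {a..b} \<Longrightarrow> h x = 0"
  shows "integrable lborel h" "(LINT x|lborel. h x) = integral {a..b} h"
proof -
  have h: "h = (\<lambda>x. indicator {a..b} x *\<^sub>R h x)"
  proof
    show "h x = indicator {a..b} x *\<^sub>R h x" for x
      using assms(2)[of x] by (cases "x \<in> {a..b}") auto
  qed
  have "set_integrable lborel {a..b} h"
    by (rule borel_integrable_atLeastAtMost'[OF assms(1)])
  then show "integrable lborel h" "(LINT x|lborel. h x) = integral {a..b} h"
    using set_borel_integral_eq_integral(2)[of "{a..b}" h] h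
    by (simp_all add: set_integrable_def set_lebesgue_integral_def)
qed

lemma DERIV_zero_outside:
  fixes w :: "real \<Rightarrow> real"
  assumes "\<And>x. x \<notin> {a..b} \<Longrightarrow> w x = 0" "x \<notin> {a..b}"
  shows "(w has_real_derivative 0) (at x)"
proof (rule has_field_derivative_transform_within_open)
  show "((\<lambda>_. 0) has_real_derivative 0) (at x)" "open (- {a..b})" by auto
qed (use assms in auto)

lemma deriv_zero_outside:
  "(\<And>x. x \<notin> {a..b} \<Longrightarrow> w x = 0) \<Longrightarrow> x \<notin> {a..b} \<Longrightarrow> deriv w x = (0::real)"
  by (rule DERIV_imp_deriv[OF DERIV_zero_outside])

lemma LINT_derivative_compact_support:
  fixes F :: "real \<Rightarrow> real"
  assumes deriv: "\<And>x. (F has_real_derivative F' x) (at x)" and cont: "continuous_on UNIV F'"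
    and support: "\<And>x. x \<notin> {a..b} \<Longrightarrow> F x = 0"
  shows "(LINT x|lborel. F' x) = 0"
proof -
  define c d where "c = a - 1" and "d = max a b + 1"
  have "(F' has_integral F d - F c) {c..d}"
    using deriv by (intro fundamental_theorem_of_calculus)
      (auto simp: c_def d_def has_field_derivative_at_within
        simp flip: has_real_derivative_iff_has_vector_derivative)
  moreover have "F c = 0" "F d = 0"
    using support[of c] support[of d] by (auto simp: c_def d_def max_def)
  ultimately have "integral {c..d} F' = 0"
    by (simp add: integral_unique)
  moreover have "F' x = 0" if "x \<notin> {c..d}" for x
    using that
    by (intro DERIV_unique[OF deriv DERIV_zero_outside[OF support]]) (auto simp: c_def d_def)
  then have "(LINT x|lborel. F' x) = integral {c..d} F'"
    by (intro continuous_compact_support_integral continuous_on_subset[OF cont]) auto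
  ultimately show ?thesis by simp
qed

lemma continuous_on_mult_compact_support:
  fixes v Q :: "real \<Rightarrow> real"
  assumes "continuous_on UNIV v" "\<And>x. x \<notin> {a..b} \<Longrightarrow> v x = 0"
    and "open S" "{a..b} \<subseteq> S" "continuous_on S Q"
  shows "continuous_on UNIV (\<lambda>x. v x * Q x)"
proof -
  have "continuous_on S (\<lambda>x. v x * Q x)"
    by (intro continuous_intros assms continuous_on_subset[OF assms(1)]) auto
  moreover have "continuous_on (- {a..b}) (\<lambda>x. v x * Q x)"
    by (rule continuous_on_cong[THEN iffD1, OF refl _ continuous_on_const[of _ 0]])
       (use assms(2) in auto)
  ultimately have "continuous_on (S \<union> - {a..b}) (\<lambda>x. v x * Q x)"
    using assms(3) by (intro continuous_on_open_Un) auto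
  moreover have "S \<union> - {a..b} = UNIV" using assms(4) by blast
  ultimately show ?thesis by simp
qed

lemma LINT_by_parts_compact_support:
  assumes w: "smooth_fun w" "\<And>x. x \<notin> {a..b} \<Longrightarrow> w x = 0" and S: "open S" "{a..b} \<subseteq> S"
    and P: "\<And>x. x \<in> S \<Longrightarrow> (P has_real_derivative P' x) (at x)" "continuous_on S P'"
  shows "(LINT x|lborel. deriv w x * P x) = - (LINT x|lborel. w x * P' x)"
proof -
  have deriv_w: "deriv w x = 0" if "x \<notin> {a..b}" for x
    by (rule deriv_zero_outside[OF w(2) that])
  have "continuous_on S P"
    by (intro continuous_at_imp_continuous_on ballI DERIV_isCont[OF P(1)])
  then have cont: "continuous_on UNIV (\<lambda>x. deriv w x * P x)" "continuous_on UNIV (\<lambda>x. w x * P' x)"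
    using continuous_on_mult_compact_support[OF smooth_fun_continuous_deriv[OF w(1)] deriv_w S]
      continuous_on_mult_compact_support[OF smooth_fun_continuous[OF w(1)] w(2) S P(2)] by auto
  then have int: "integrable lborel (\<lambda>x. deriv w x * P x)" "integrable lborel (\<lambda>x. w x * P' x)"
    by (auto intro!: continuous_compact_support_integral[of a b] simp: w(2) deriv_w
        elim!: continuous_on_subset)
  have "(LINT x|lborel. deriv w x * P x + w x * P' x) = 0"
  proof (rule LINT_derivative_compact_support)
    show "((\<lambda>x. w x * P x) has_real_derivative deriv w x * P x + w x * P' x) (at x)" for x
    proof (cases "x \<in> {a..b}")
      case True
      then show ?thesis
        using DERIV_mult[OF smooth_fun_DERIV[OF w(1)] P(1), of x] S(2) by (auto simp: mult.commute)
    next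
      case False
      then show ?thesis
        using DERIV_zero_outside[of a b "\<lambda>x. w x * P x" x] by (simp add: w(2) deriv_w)
    qed
    show "w x * P x = 0" if "x \<notin> {a..b}" for x
      using w(2)[OF that] by simp
  qed (intro continuous_on_add cont)
  then show ?thesis
    using int by simp
qed

lemma weak_deriv_classical:
  assumes f: "continuous_on {-1..1} f" and g: "continuous_on {-1..1} g"
    and deriv: "\<And>x. x \<in> Ioo11 \<Longrightarrow> (f has_real_derivative g x) (at x)"
  shows "weak_deriv f g"
  unfolding weak_deriv_def
proof (intro conjI allI impI)
  show "loc_int f" "loc_int g"
    unfolding loc_int_def using f g
    by (auto intro!: borel_integrable_atLeastAtMost' elim!: continuous_on_subset)
  fix \<phi> assume "test_fun_x \<phi>"
  then obtain a b where ab: "-1 < a" "b < 1" and zero: "\<And>x. x \<notin> {a..b} \<Longrightarrow> \<phi> x = 0"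
    and \<phi>: "smooth_fun \<phi>"
    unfolding test_fun_x_def by blast
  then have support: "\<phi> x = 0" "deriv \<phi> x = 0" if "x \<notin> Ioo11" for x
    using that deriv_zero_outside[OF zero] by auto
  have "(LINT x:Ioo11|lborel. f x * deriv \<phi> x) = (LINT x|lborel. deriv \<phi> x * f x)"
    "(LINT x:Ioo11|lborel. g x * \<phi> x) = (LINT x|lborel. \<phi> x * g x)"
    unfolding set_lebesgue_integral_def
    by (intro Bochner_Integration.integral_cong; use support in \<open>auto simp: indicator_def\<close>)+
  moreover have "(LINT x|lborel. deriv \<phi> x * f x) = - (LINT x|lborel. \<phi> x * g x)"
    using ab by (intro LINT_by_parts_compact_support[OF \<phi> zero, of a b Ioo11] deriv
        continuous_on_subset[OF g]) auto
  ultimately show "(LINT x:Ioo11|lborel. f x * deriv \<phi> x) = - (LINT x:Ioo11|lborel. g x * \<phi> x)"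
    by simp
qed

abbreviation continuous_up_to_boundary :: "(real \<Rightarrow> real \<Rightarrow> real) \<Rightarrow> bool" where
  "continuous_up_to_boundary F \<equiv> continuous_on ({-1..1} \<times> {0<..}) (\<lambda>(x, t). F x t)"

lemma continuous_on_slice:
  assumes "continuous_up_to_boundary F" "t > 0"
  shows "continuous_on {-1..1} (\<lambda>x. F x t)"
  by (rule continuous_on_compose2[OF assms(1), of _ "\<lambda>x. (x, t)", simplified])
     (use assms(2) in \<open>auto intro!: continuous_intros\<close>)

lemma continuous_on_swapped:
  assumes "continuous_up_to_boundary F"
  shows "continuous_on ({0<..} \<times> cbox (-1) 1) (\<lambda>(t, x). F x t)"
  unfolding split_beta
  by (rule continuous_on_compose2[OF assms, of _ "\<lambda>p. (snd p, fst p)",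
        unfolded split_beta, simplified])
     (auto intro!: continuous_intros)

lemma continuous_imp_L2loc_L2:
  assumes "continuous_up_to_boundary F"
  shows "L2loc_L2 F"
  unfolding L2loc_L2_def lborel_prod
proof (intro conjI allI impI)
  have "continuous_on (Ioo11 \<times> {0<..}) (\<lambda>(x, t). F x t)"
    by (rule continuous_on_subset[OF assms]) auto
  then show "set_borel_measurable lborel (Ioo11 \<times> {0<..}) (\<lambda>(x, t). F x t)"
    using set_measurable_continuous_on[of "Ioo11 \<times> {0<..}" "\<lambda>(x, t). F x t"]
    by (simp add: borel_Times set_borel_measurable_def)
  fix a b :: real assume "0 < a"
  then have "continuous_on ({-1..1} \<times> {a..b}) (\<lambda>(x, t). F x t)"
    by (intro continuous_on_subset[OF assms]) auto
  then have "continuous_on ({-1..1} \<times> {a..b}) (\<lambda>(x, t). (F x t)\<^sup>2)"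
    by (auto simp: split_beta intro: continuous_intros)
  then have "set_integrable lborel ({-1..1} \<times> {a..b}) (\<lambda>(x, t). (F x t)\<^sup>2)"
    unfolding set_integrable_def by (intro borel_integrable_compact compact_Times) auto
  then show "set_integrable lborel (Ioo11 \<times> {a..b}) (\<lambda>(x, t). (F x t)\<^sup>2)"
    by (rule set_integrable_subset) (auto simp: borel_Times)
qed

lemma L2_dist_slices_tendsto:
  assumes F: "continuous_up_to_boundary F" and t: "t > 0"
  shows "((\<lambda>s. L2_dist (\<lambda>x. F x s) (\<lambda>x. F x t)) \<longlongrightarrow> 0) (at t)"
proof -
  have "continuous_on ({0<..} \<times> cbox (-1) 1) (\<lambda>(s, x). (F x s - F x t)\<^sup>2)"
    using continuous_on_swapped[OF F] unfolding split_beta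
    by (intro continuous_intros continuous_on_compose2[OF continuous_on_slice[OF F t], of _ snd])
       auto
  then have "continuous_on {0<..} (\<lambda>s. sqrt (integral (cbox (-1) 1) (\<lambda>x. (F x s - F x t)\<^sup>2)))"
    by (intro continuous_intros integral_continuous_on_param)
  then have "((\<lambda>s. sqrt (integral {-1..1} (\<lambda>x. (F x s - F x t)\<^sup>2))) \<longlongrightarrow> 0) (at t)"
    using t by (auto simp: continuous_on_eq_continuous_at isCont_def dest!: bspec[of _ _ t])
  moreover have "\<forall>\<^sub>F s in at t.
      sqrt (integral {-1..1} (\<lambda>x. (F x s - F x t)\<^sup>2)) = L2_dist (\<lambda>x. F x s) (\<lambda>x. F x t)"
    using eventually_at_in_open'[of "{0<..}" t] t
    by (auto elim!: eventually_mono simp: L2_dist_continuous continuous_on_slice[OF F])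
  ultimately show ?thesis
    by (rule Lim_transform_eventually)
qed

lemma continuous_imp_C_L2: "continuous_up_to_boundary G \<Longrightarrow> C_L2 G"
  unfolding C_L2_def by (auto intro: L2_dist_slices_tendsto L2_continuous continuous_on_slice)

lemma L2_dist_cong_AE:
  assumes "loc_int f" "loc_int g" "loc_int f'" "loc_int g'"
    and "AE x in lborel. x \<in> Ioo11 \<longrightarrow> f x = f' x" "AE x in lborel. x \<in> Ioo11 \<longrightarrow> g x = g' x"
  shows "L2_dist f g = L2_dist f' g'"
proof -
  have meas: "(\<lambda>x. (h x - k x)\<^sup>2) \<in> borel_measurable lborel11" if "loc_int h" "loc_int k" for h k
    using that[THEN loc_int_measurable] unfolding set_borel_measurable_lborel11
    by (intro borel_measurable_power borel_measurable_diff)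
  have "AE x in lborel11. (f x - g x)\<^sup>2 = (f' x - g' x)\<^sup>2"
    using assms(5,6) by (auto simp: AE_restrict_space_iff)
  then show ?thesis
    unfolding L2_dist_def LINT_lborel11
    by (intro arg_cong[of _ _ sqrt] integral_cong_AE meas assms)
qed

lemma trace_at_boundary_continuous:
  assumes "continuous_on {-1..1} f"
  shows "trace_at_1 f (f 1)" "trace_at_m1 f (f (-1))"
proof -
  have "(f \<longlongrightarrow> f 1) (at 1 within {-1..1})" "(f \<longlongrightarrow> f (-1)) (at (-1) within {-1..1})"
    using assms by (auto simp: continuous_on)
  then have "(f \<longlongrightarrow> f 1) (at_left 1)" "(f \<longlongrightarrow> f (-1)) (at_right (-1))"
    by (simp_all add: at_within_Icc_at_left at_within_Icc_at_right)
  moreover have "continuous_on Ioo11 f"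
    by (rule continuous_on_subset[OF assms]) auto
  ultimately show "trace_at_1 f (f 1)" "trace_at_m1 f (f (-1))"
    unfolding trace_at_1_def trace_at_m1_def by auto
qed

lemma smooth_fun_poly: "smooth_fun (poly p)"
  by (rule smooth_fun_coinduct[where S = "range poly"]) (use poly_DERIV in blast)+

lemma test_fun_x_mult_smooth:
  assumes "smooth_fun f" "test_fun_x v"
  shows "test_fun_x (\<lambda>x. f x * v x)"
  using assms smooth_fun_mult[of f v] unfolding test_fun_x_def by fastforce

lemma test_fun_x_weighted:
  assumes "test_fun_x v"
  shows "test_fun_x (\<lambda>x. (1 - x\<^sup>2) * v x)"
    and "deriv (\<lambda>x. (1 - x\<^sup>2) * v x) x = (1 - x\<^sup>2) * deriv v x - 2 * x * v x"
proof -
  have "poly [:1, 0, -1:] = (\<lambda>x::real. 1 - x\<^sup>2)"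
    by (simp add: fun_eq_iff power2_eq_square)
  then show "test_fun_x (\<lambda>x. (1 - x\<^sup>2) * v x)"
    using test_fun_x_mult_smooth[OF smooth_fun_poly assms] by metis
  show "deriv (\<lambda>x. (1 - x\<^sup>2) * v x) x = (1 - x\<^sup>2) * deriv v x - 2 * x * v x"
    by (rule DERIV_imp_deriv)
       (auto intro!: derivative_eq_intros smooth_fun_DERIV test_fun_x_smooth[OF assms])
qed

lemma pair_eq_integral:
  assumes "continuous_up_to_boundary F" "smooth_fun v" "t > 0"
  shows "pair F v t = integral (cbox (-1) 1) (\<lambda>x. F x t * v x)"
  unfolding pair_def cbox_interval
  by (intro LINT_Ioo_continuous continuous_intros continuous_on_slice smooth_fun_continuous assms)

lemma continuous_on_swapped_mult:
  assumes "continuous_up_to_boundary F" "smooth_fun v"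
  shows "continuous_on ({0<..} \<times> cbox (-1) 1) (\<lambda>(t, x). F x t * v x)"
  using continuous_on_swapped[OF assms(1)] unfolding split_beta
  by (intro continuous_intros
      continuous_on_compose2[OF smooth_fun_continuous[OF assms(2), of UNIV]]) auto

lemma continuous_on_pair:
  assumes "continuous_up_to_boundary F" "smooth_fun v"
  shows "continuous_on {0<..} (pair F v)"
proof -
  have "continuous_on {0<..} (\<lambda>t. integral (cbox (-1) 1) (\<lambda>x. F x t * v x))"
    by (intro integral_continuous_on_param continuous_on_swapped_mult assms)
  then show ?thesis
    by (rule continuous_on_cong[THEN iffD1, OF refl, rotated]) (simp add: pair_eq_integral assms)
qed

lemma pair_DERIV:
  assumes F: "continuous_up_to_boundary F" and Ft: "continuous_up_to_boundary Ft"
    and v: "smooth_fun v"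
    and deriv: "\<And>x t. x \<in> {-1..1} \<Longrightarrow> t > 0 \<Longrightarrow> ((\<lambda>t. F x t) has_real_derivative Ft x t) (at t)"
    and t: "t > 0"
  shows "(pair F v has_real_derivative pair Ft v t) (at t)"
proof -
  have "((\<lambda>t. integral (cbox (-1) 1) (\<lambda>x. F x t * v x)) has_real_derivative
      integral (cbox (-1) 1) (\<lambda>x. Ft x t * v x)) (at t within {0<..})"
  proof (rule leibniz_rule_field_derivative)
    show "continuous_on ({0<..} \<times> cbox (-1) 1) (\<lambda>(t, x). Ft x t * v x)"
      by (rule continuous_on_swapped_mult[OF Ft v])
    show "(\<lambda>x. F x t * v x) integrable_on cbox (-1) 1" if "t \<in> {0<..}" for t
      unfolding cbox_interval using that
      by (intro integrable_continuous_real continuous_on_mult continuous_on_slice[OF F]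
          smooth_fun_continuous[OF v]) auto
    show "((\<lambda>t. F x t * v x) has_real_derivative Ft x t * v x) (at t within {0<..})"
      if "t \<in> {0<..}" "x \<in> cbox (-1) 1" for t x
      using that by (intro DERIV_cmult_right has_field_derivative_at_within[OF deriv]) auto
  qed (use t in auto)
  then have "((\<lambda>t. integral (cbox (-1) 1) (\<lambda>x. F x t * v x)) has_real_derivative
      pair Ft v t) (at t)"
    using t by (simp add: at_within_open[of t "{0<..}"] pair_eq_integral[OF Ft v])
  then show ?thesis
    by (rule has_field_derivative_transform_within_open[of _ _ _ "{0<..}"])
       (use t in \<open>auto simp: pair_eq_integral[OF F v]\<close>)
qed

locale classical_solution =
  fixes lam p :: real and G0 :: "real \<Rightarrow> real" and G Gx Gxx :: "real \<Rightarrow> real \<Rightarrow> real"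
  assumes continuous: "continuous_up_to_boundary G" "continuous_up_to_boundary Gx"
      "continuous_up_to_boundary Gxx"
    and DERIV_x: "x \<in> Ioo11 \<Longrightarrow> t > 0 \<Longrightarrow> ((\<lambda>x. G x t) has_real_derivative Gx x t) (at x)"
    and DERIV_xx: "x \<in> Ioo11 \<Longrightarrow> t > 0 \<Longrightarrow> ((\<lambda>x. Gx x t) has_real_derivative Gxx x t) (at x)"
    and pde: "x \<in> {-1..1} \<Longrightarrow> t > 0 \<Longrightarrow>
      ((\<lambda>t. G x t) has_real_derivative lam / 2 * (1 - x\<^sup>2) * Gxx x t) (at t)"
    and boundary: "t > 0 \<Longrightarrow> G 1 t = 1" "t > 0 \<Longrightarrow> G (-1) t = p"
    and initial: "((\<lambda>t. L2_dist (\<lambda>x. G x t) G0) \<longlongrightarrow> 0) (at_right 0)"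
begin

definition Gt :: "real \<Rightarrow> real \<Rightarrow> real" where
  "Gt x t = lam / 2 * (1 - x\<^sup>2) * Gxx x t"

lemma continuous_Gt: "continuous_up_to_boundary Gt"
  unfolding Gt_def using continuous(3) by (auto simp: split_beta intro!: continuous_intros)

lemma DERIV_t: "x \<in> {-1..1} \<Longrightarrow> t > 0 \<Longrightarrow> ((\<lambda>t. G x t) has_real_derivative Gt x t) (at t)"
  unfolding Gt_def by (rule pde)

lemma weak_deriv_x: "t > 0 \<Longrightarrow> weak_deriv (\<lambda>x. G x t) (\<lambda>x. Gx x t)"
  by (intro weak_deriv_classical continuous_on_slice continuous DERIV_x)

lemma weak_deriv_xx: "t > 0 \<Longrightarrow> weak_deriv (\<lambda>x. Gx x t) (\<lambda>x. Gxx x t)"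
  by (intro weak_deriv_classical continuous_on_slice continuous DERIV_xx)

lemma L2loc_L2_weighted:
  assumes "continuous_up_to_boundary F"
  shows "L2loc_L2 (\<lambda>x t. sqrt (1 - x\<^sup>2) * F x t)"
  using assms by (intro continuous_imp_L2loc_L2) (auto simp: split_beta intro!: continuous_intros)

lemma L2loc_H1rho_G: "L2loc_H1rho G Gx"
  unfolding L2loc_H1rho_def
  by (intro conjI continuous_imp_L2loc_L2 L2loc_L2_weighted continuous AE_I2 impI weak_deriv_x)

lemma L2loc_H1rho_Gx: "L2loc_H1rho Gx Gxx"
  unfolding L2loc_H1rho_def
  by (intro conjI continuous_imp_L2loc_L2 L2loc_L2_weighted continuous AE_I2 impI weak_deriv_xx)

text \<open>\<^const>\<open>H1_dist\<close> compares the weak derivatives picked by \<^const>\<open>wderiv\<close>, which agree with \<^term>\<open>Gx\<close>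
  only almost everywhere.\<close>

lemma L2_dist_wderiv:
  assumes "s > 0" "t > 0"
  shows "L2_dist (wderiv (\<lambda>x. G x s)) (wderiv (\<lambda>x. G x t)) = L2_dist (\<lambda>x. Gx x s) (\<lambda>x. Gx x t)"
proof -
  have wderiv: "weak_deriv (\<lambda>x. G x t) (wderiv (\<lambda>x. G x t))" if "t > 0" for t
    unfolding wderiv_def by (rule someI[of "weak_deriv (\<lambda>x. G x t)", OF weak_deriv_x[OF that]])
  show ?thesis
    using assms
    by (intro L2_dist_cong_AE weak_deriv_unique[OF wderiv weak_deriv_x])
       (use wderiv weak_deriv_x in \<open>auto simp: weak_deriv_def\<close>)
qed

lemma C_H1_G: "C_H1 G"
  unfolding C_H1_def
proof (intro conjI allI impI)
  show "H1 (\<lambda>x. G x t)" if "t > 0" for t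
    unfolding H1_def using that
    by (intro conjI exI[of _ "\<lambda>x. Gx x t"] weak_deriv_x L2_continuous continuous_on_slice
        continuous)
  fix t :: real assume t: "t > 0"
  have "((\<lambda>s. sqrt ((L2_dist (\<lambda>x. G x s) (\<lambda>x. G x t))\<^sup>2 + (L2_dist (\<lambda>x. Gx x s) (\<lambda>x. Gx x t))\<^sup>2))
      \<longlongrightarrow> sqrt (0\<^sup>2 + 0\<^sup>2)) (at t)"
    by (intro tendsto_intros L2_dist_slices_tendsto continuous t)
  moreover have "\<forall>\<^sub>F s in at t.
      sqrt ((L2_dist (\<lambda>x. G x s) (\<lambda>x. G x t))\<^sup>2 + (L2_dist (\<lambda>x. Gx x s) (\<lambda>x. Gx x t))\<^sup>2)
      = H1_dist (\<lambda>x. G x s) (\<lambda>x. G x t)"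
    using eventually_at_in_open'[of "{0<..}" t] t
    by (auto elim!: eventually_mono simp: H1_dist_def L2_dist_wderiv)
  ultimately show "((\<lambda>s. H1_dist (\<lambda>x. G x s) (\<lambda>x. G x t)) \<longlongrightarrow> 0) (at t)"
    by (simp add: tendsto_cong)
qed

lemma distributional_deriv_t:
  assumes v: "test_fun_x v" and w: "test_fun_t w"
  shows "(LINT t|lborel. deriv w t * pair G v t) = - (LINT t|lborel. w t * pair Gt v t)"
proof -
  obtain a b where "0 < a" "\<And>t. t \<notin> {a..b} \<Longrightarrow> w t = 0" "smooth_fun w"
    using w unfolding test_fun_t_def by blast
  then show ?thesis
    using test_fun_x_smooth[OF v]
    by (intro LINT_by_parts_compact_support[where S = "{0<..}"] pair_DERIV continuous_on_pair
        continuous continuous_Gt DERIV_t) auto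
qed

lemma dt_L2loc_L2_G: "dt_L2loc_L2 G"
  unfolding dt_L2loc_L2_def
  using continuous_imp_L2loc_L2[OF continuous_Gt] distributional_deriv_t by blast

lemma dt_L2loc_Hm1_G: "dt_L2loc_Hm1 G"
  unfolding dt_L2loc_Hm1_def
proof (rule exI[of _ Gt], rule exI[of _ "\<lambda>x t. 0"], intro conjI allI impI)
  show "L2loc_L2 (\<lambda>x t. 0)"
    by (rule continuous_imp_L2loc_L2) (simp add: split_beta)
  show "(LINT t|lborel. deriv w t * pair G v t)
      = - (LINT t|lborel. w t * (pair Gt v t - pair (\<lambda>x t. 0) (deriv v) t))"
    if "test_fun_x v" "test_fun_t w" for v w
    using distributional_deriv_t[OF that] by (simp add: pair_def[of "\<lambda>x t. 0"])
qed (rule continuous_imp_L2loc_L2[OF continuous_Gt])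

lemma pair_Gt:
  assumes v: "test_fun_x v" and t: "t > 0"
  shows "pair Gt v t
    = - (lam / 2 * (LINT x:Ioo11|lborel. Gx x t * ((1 - x\<^sup>2) * deriv v x - 2 * x * v x)))"
proof -
  have "pair Gt v t = (LINT x:Ioo11|lborel. lam / 2 * (Gxx x t * ((1 - x\<^sup>2) * v x)))"
    unfolding pair_def Gt_def by (simp add: mult_ac)
  also have "\<dots> = lam / 2 * (LINT x:Ioo11|lborel. Gxx x t * ((1 - x\<^sup>2) * v x))"
    by (rule set_integral_mult_right)
  also have "(LINT x:Ioo11|lborel. Gxx x t * ((1 - x\<^sup>2) * v x))
      = - (LINT x:Ioo11|lborel. Gx x t * deriv (\<lambda>x. (1 - x\<^sup>2) * v x) x)"
    using weak_deriv_xx[OF t] test_fun_x_weighted(1)[OF v] unfolding weak_deriv_def by simp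
  finally show ?thesis
    unfolding test_fun_x_weighted(2)[OF v] by simp
qed

lemma weak_pde_G: "weak_pde lam G Gx"
  unfolding weak_pde_def
proof (intro allI impI)
  fix v w assume v: "test_fun_x v" and w: "test_fun_t w"
  define J where "J t = (LINT x:Ioo11|lborel. Gx x t * ((1 - x\<^sup>2) * deriv v x - 2 * x * v x))" for t
  have "w t = 0" if "t \<le> 0" for t
    using w that unfolding test_fun_t_def by force
  then have "w t * pair Gt v t = - (lam / 2) * (w t * J t)" for t
    by (cases "t > 0") (simp_all add: pair_Gt[OF v] J_def)
  then have "(LINT t|lborel. deriv w t * pair G v t) = - (LINT t|lborel. - (lam / 2) * (w t * J t))"
    using distributional_deriv_t[OF v w] by simp
  also have "\<dots> = lam / 2 * (LINT t|lborel. w t * J t)"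
    by (simp only: integral_mult_right_zero)
  finally show "(LINT t|lborel. deriv w t * pair G v t) = lam / 2 * (LINT t|lborel. w t *
      (LINT x:Ioo11|lborel. Gx x t * ((1 - x\<^sup>2) * deriv v x - 2 * x * v x)))"
    unfolding J_def .
qed

lemma weak_solution_G: "weak_solution lam G0 p G Gx"
proof -
  have "trace_at_1 (\<lambda>x. G x t) 1 \<and> trace_at_m1 (\<lambda>x. G x t) p" if "t > 0" for t
    using trace_at_boundary_continuous[OF continuous_on_slice[OF continuous(1) that]]
      boundary[OF that] by simp
  then show ?thesis
    unfolding weak_solution_def
    using continuous_imp_C_L2[OF continuous(1)] L2loc_H1rho_G dt_L2loc_Hm1_G weak_pde_G initial
    by blast
qed

end

section \<open>Series of decaying modes\<close>

lemma power_mult_exp_bounded: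
  fixes m :: real
  assumes "m > 0"
  shows "\<exists>B. \<forall>y\<ge>0. y ^ k * exp (- (m * y)) \<le> B"
proof (intro exI allI impI)
  fix y :: real assume y: "y \<ge> 0"
  have "(\<Sum>n\<in>{k}. (m * y) ^ n /\<^sub>R fact n) \<le> exp (m * y)"
    unfolding exp_def using y assms by (intro sum_le_suminf summable_exp_generic) auto
  then have "(m * y) ^ k / fact k \<le> exp (m * y)"
    by (simp add: divide_inverse mult.commute)
  then show "y ^ k * exp (- (m * y)) \<le> fact k / m ^ k"
    using assms by (simp add: exp_minus field_simps)
qed

locale decay_rates =
  fixes rate :: "nat \<Rightarrow> real"
  assumes rate_nonneg: "rate n \<ge> 0"
    and summable_exp_rate: "t > 0 \<Longrightarrow> summable (\<lambda>n. exp (- (rate n * t)))"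
begin

definition mode_series :: "(nat \<Rightarrow> 'a \<Rightarrow> real) \<Rightarrow> 'a \<Rightarrow> real \<Rightarrow> real" where
  "mode_series f x t = (\<Sum>n. exp (- (rate n * t)) * f n x)"

definition tempered :: "'a set \<Rightarrow> (nat \<Rightarrow> 'a \<Rightarrow> real) \<Rightarrow> bool" where
  "tempered S f \<longleftrightarrow> (\<exists>A k. \<forall>n. \<forall>x\<in>S. \<bar>f n x\<bar> \<le> A * (1 + rate n) ^ k)"

lemma tempered_mono:
  assumes "tempered S g" "\<And>n x. x \<in> S \<Longrightarrow> \<bar>f n x\<bar> \<le> \<bar>g n x\<bar>"
  shows "tempered S f"
  using assms unfolding tempered_def by (meson order_trans)

lemma tempered_bounded:
  assumes "\<And>n x. x \<in> S \<Longrightarrow> \<bar>f n x\<bar> \<le> B"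
  shows "tempered S f"
  unfolding tempered_def using assms by (intro exI[of _ B] exI[of _ 0]) simp

lemma tempered_rate: "tempered S (\<lambda>n x. rate n)"
  unfolding tempered_def using rate_nonneg by (intro exI[of _ 1]) (auto intro!: exI[of _ 1])

lemma tempered_mult:
  assumes "tempered S f" "tempered S g"
  shows "tempered S (\<lambda>n x. f n x * g n x)"
proof -
  obtain A j where f: "\<And>n x. x \<in> S \<Longrightarrow> \<bar>f n x\<bar> \<le> A * (1 + rate n) ^ j"
    using assms(1) unfolding tempered_def by blast
  obtain B k where g: "\<And>n x. x \<in> S \<Longrightarrow> \<bar>g n x\<bar> \<le> B * (1 + rate n) ^ k"
    using assms(2) unfolding tempered_def by blast
  have "\<bar>f n x * g n x\<bar> \<le> (A * B) * (1 + rate n) ^ (j + k)" if "x \<in> S" for n x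
  proof -
    have "\<bar>f n x\<bar> * \<bar>g n x\<bar> \<le> (A * (1 + rate n) ^ j) * (B * (1 + rate n) ^ k)"
      using f[OF that] g[OF that] by (intro mult_mono order_trans[OF abs_ge_zero f[OF that]]) auto
    then show ?thesis by (simp add: abs_mult power_add mult_ac)
  qed
  then show ?thesis unfolding tempered_def by blast
qed

lemma tempered_cmult: "tempered S f \<Longrightarrow> tempered S (\<lambda>n x. c * f n x)"
  by (rule tempered_mult[OF tempered_bounded[of S _ "\<bar>c\<bar>"]]) auto

lemma summable_exp_rate_mult_power:
  assumes t: "t > 0"
  shows "summable (\<lambda>n. exp (- (rate n * t)) * (A * (1 + rate n) ^ k))"
proof -
  obtain B where B: "\<And>y. y \<ge> 0 \<Longrightarrow> y ^ k * exp (- (t / 2 * y)) \<le> B"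
    using power_mult_exp_bounded[of "t / 2" k] t by auto
  have "summable (\<lambda>n. exp (- (rate n * t)) * (1 + rate n) ^ k)"
  proof (rule summable_comparison_test')
    show "summable (\<lambda>n. (exp (t / 2) * B) * exp (- (rate n * (t / 2))))"
      using t by (intro summable_mult summable_exp_rate) simp
    fix n
    have "exp (- (rate n * t)) * (1 + rate n) ^ k
        = exp (t / 2) * ((1 + rate n) ^ k * exp (- (t / 2 * (1 + rate n))))
          * exp (- (rate n * (t / 2)))"
      by (simp add: field_simps flip: exp_add)
    also have "\<dots> \<le> (exp (t / 2) * B) * exp (- (rate n * (t / 2)))"
      using B[of "1 + rate n"] rate_nonneg[of n] by (intro mult_right_mono mult_left_mono) auto
    finally show "norm (exp (- (rate n * t)) * (1 + rate n) ^ k)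
        \<le> (exp (t / 2) * B) * exp (- (rate n * (t / 2)))"
      using rate_nonneg[of n] by simp
  qed
  from summable_mult[OF this, of A] show ?thesis
    by (simp add: mult_ac)
qed

lemma mode_series_term_bound:
  assumes "\<bar>y\<bar> \<le> B" "d \<le> t"
  shows "norm (exp (- (rate n * t)) * y) \<le> exp (- (rate n * d)) * B"
proof -
  have "exp (- (rate n * t)) \<le> exp (- (rate n * d))"
    using assms(2) rate_nonneg[of n] by (simp add: mult_left_mono)
  then show ?thesis
    unfolding real_norm_def abs_mult using assms(1) by (intro mult_mono) auto
qed

lemma mode_series_summable:
  assumes "t > 0" "tempered S f" "x \<in> S"
  shows "summable (\<lambda>n. exp (- (rate n * t)) * f n x)"
proof -
  obtain A k where f: "\<And>n x. x \<in> S \<Longrightarrow> \<bar>f n x\<bar> \<le> A * (1 + rate n) ^ k"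
    using assms(2) unfolding tempered_def by blast
  show ?thesis
    by (rule summable_comparison_test'[OF summable_exp_rate_mult_power[OF assms(1)]])
       (rule mode_series_term_bound[OF f[OF assms(3)] order_refl])
qed

lemma mode_series_uniform_limit:
  assumes "d > 0" "tempered S f"
  shows "uniform_limit (S \<times> {d..}) (\<lambda>n p. \<Sum>i<n. exp (- (rate i * snd p)) * f i (fst p))
     (\<lambda>p. mode_series f (fst p) (snd p)) sequentially"
proof -
  obtain A k where f: "\<And>n x. x \<in> S \<Longrightarrow> \<bar>f n x\<bar> \<le> A * (1 + rate n) ^ k"
    using assms(2) unfolding tempered_def by blast
  show ?thesis
    unfolding mode_series_def
    by (rule Weierstrass_m_test[OF _ summable_exp_rate_mult_power[OF assms(1), of A k]])
       (intro mode_series_term_bound f; auto)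
qed

lemma mode_series_continuous_on:
  fixes f :: "nat \<Rightarrow> 'a::t2_space \<Rightarrow> real"
  assumes f: "tempered S f" and cont: "\<And>n. continuous_on S (f n)"
  shows "continuous_on (S \<times> {0<..}) (\<lambda>(x, t). mode_series f x t)"
  unfolding continuous_on_eq_continuous_within
proof
  fix p :: "'a \<times> real" assume p: "p \<in> S \<times> {0<..}"
  define d where "d = snd p / 2"
  have d: "d > 0" "snd p > d" using p by (auto simp: d_def)
  have "continuous_on (S \<times> {d..}) (\<lambda>p. mode_series f (fst p) (snd p))"
  proof (rule uniform_limit_theorem[OF _ mode_series_uniform_limit[OF d(1) f]])
    show "\<forall>\<^sub>F n in sequentially. continuous_on (S \<times> {d..})
        (\<lambda>p. \<Sum>i<n. exp (- (rate i * snd p)) * f i (fst p))"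
      by (intro always_eventually allI continuous_intros continuous_on_compose2[OF cont]) auto
  qed simp
  then have "continuous (at p within S \<times> {d..}) (\<lambda>p. mode_series f (fst p) (snd p))"
    using p d unfolding continuous_on_eq_continuous_within by (cases p) auto
  also have "at p within S \<times> {d..} = at p within S \<times> {0<..}"
    by (rule at_within_nhd[of p "UNIV \<times> {d<..}"]) (use p d in \<open>auto simp: open_Times mem_Times_iff\<close>)
  finally show "continuous (at p within S \<times> {0<..}) (\<lambda>(x, t). mode_series f x t)"
    by (simp add: case_prod_unfold)
qed

lemma mode_series_DERIV_x:
  fixes f f' :: "nat \<Rightarrow> real \<Rightarrow> real"
  assumes S: "convex S" "x \<in> interior S" and f: "tempered S f" "tempered S f'" and t: "t > 0"
    and deriv: "\<And>n x. x \<in> S \<Longrightarrow> (f n has_real_derivative f' n x) (at x within S)"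
  shows "((\<lambda>x. mode_series f x t) has_real_derivative mode_series f' x t) (at x)"
  unfolding mode_series_def
proof (rule has_field_derivative_series'(2)[where S = S and ?x0.0 = x
      and f = "\<lambda>n x. exp (- (rate n * t)) * f n x" and f' = "\<lambda>n x. exp (- (rate n * t)) * f' n x"])
  have x: "x \<in> S" using S(2) interior_subset by blast
  then show "x \<in> S" "summable (\<lambda>n. exp (- (rate n * t)) * f n x)"
    using mode_series_summable[OF t f(1)] by auto
  have "uniform_limit S (\<lambda>n x. \<Sum>i<n. exp (- (rate i * t)) * f' i x)
      (\<lambda>x. mode_series f' x t) sequentially"
    using uniform_limit_compose'[OF mode_series_uniform_limit[OF t f(2)], of "\<lambda>x. (x, t)" S] by auto
  then show "uniformly_convergent_on S (\<lambda>n x. \<Sum>i<n. exp (- (rate i * t)) * f' i x)"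
    unfolding uniformly_convergent_on_def by blast
qed (use S deriv in \<open>auto intro: DERIV_cmult\<close>)

lemma mode_series_DERIV_t:
  assumes f: "tempered S f" and x: "x \<in> S" and t: "t > 0"
  shows "((\<lambda>t. mode_series f x t) has_real_derivative
    mode_series (\<lambda>n x. - rate n * f n x) x t) (at t)"
  unfolding mode_series_def
proof (rule has_field_derivative_series'(2)[where S = "{t/2..}" and ?x0.0 = t
      and f = "\<lambda>n t. exp (- (rate n * t)) * f n x"
      and f' = "\<lambda>n t. exp (- (rate n * t)) * (- rate n * f n x)"])
  show "((\<lambda>t. exp (- (rate n * t)) * f n x) has_real_derivative
      exp (- (rate n * s)) * (- rate n * f n x)) (at s within {t/2..})" for n s
    by (auto intro!: derivative_eq_intros)
  have f': "tempered S (\<lambda>n x. - rate n * f n x)"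
    using tempered_mult[OF tempered_cmult[OF tempered_rate, of S "-1"] f] by simp
  have "uniform_limit {t/2..} (\<lambda>n s. \<Sum>i<n. exp (- (rate i * s)) * (- rate i * f i x))
      (\<lambda>s. mode_series (\<lambda>n x. - rate n * f n x) x s) sequentially"
    using uniform_limit_compose'[OF mode_series_uniform_limit[OF _ f', of "t/2"],
        of "\<lambda>s. (x, s)" "{t/2..}"] t x
    by auto
  then show "uniformly_convergent_on {t/2..}
      (\<lambda>n s. \<Sum>i<n. exp (- (rate i * s)) * (- rate i * f i x))"
    unfolding uniformly_convergent_on_def by blast
  show "summable (\<lambda>n. exp (- (rate n * t)) * f n x)"
    by (rule mode_series_summable[OF t f x])
qed (use t in auto)

lemma mode_series_diff:
  assumes "t > 0" "tempered S f" "tempered S g" "x \<in> S"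
  shows "mode_series (\<lambda>n x. f n x - g n x) x t = mode_series f x t - mode_series g x t"
  unfolding mode_series_def right_diff_distrib
  by (intro suminf_diff[symmetric] mode_series_summable[OF assms(1) _ assms(4)] assms)

lemma mode_series_cmult:
  assumes "t > 0" "tempered S f" "x \<in> S"
  shows "mode_series (\<lambda>n x. c x * f n x) x t = c x * mode_series f x t"
  unfolding mode_series_def
  by (subst suminf_mult[OF mode_series_summable[OF assms], symmetric]) (simp add: mult_ac)

lemma abs_mode_series_le:
  assumes "t > 0" "tempered S g" "x \<in> S" and "\<And>n. \<bar>f n y\<bar> \<le> g n x"
  shows "\<bar>mode_series f y t\<bar> \<le> mode_series g x t"
  unfolding mode_series_def real_norm_def[symmetric]
  by (intro norm_suminf_le mode_series_summable[OF assms(1-3)] mode_series_term_bound assms(4)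
      order_refl)

end

section \<open>Integrals of polynomials\<close>

definition poly_integral :: "real \<Rightarrow> real \<Rightarrow> real poly \<Rightarrow> real" where
  "poly_integral a b p = integral {a..b} (poly p)"

lemma poly_integrable: "poly p integrable_on {a..b}" for p :: "real poly"
  by (intro integrable_continuous_real continuous_intros)

lemma poly_integral_add: "poly_integral a b (p + q) = poly_integral a b p + poly_integral a b q"
  using integral_add[OF poly_integrable poly_integrable, of a b p q]
  by (simp add: poly_integral_def poly_add[abs_def])

lemma poly_integral_smult: "poly_integral a b (smult c p) = c * poly_integral a b p"
  by (simp add: poly_integral_def poly_smult[abs_def])

lemma poly_integral_sum: "poly_integral a b (\<Sum>i\<in>I. f i) = (\<Sum>i\<in>I. poly_integral a b (f i))"
proof (induction I rule: infinite_finite_induct)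
  case (insert i I)
  then show ?case by (simp add: poly_integral_add)
qed (simp_all add: poly_integral_def poly_0[abs_def])

lemma poly_integral_pderiv:
  assumes "a \<le> b"
  shows "poly_integral a b (pderiv p) = poly p b - poly p a"
proof -
  have "(poly (pderiv p) has_integral poly p b - poly p a) {a..b}"
    using assms
    by (intro fundamental_theorem_of_calculus)
       (auto intro: has_field_derivative_at_within[OF poly_DERIV]
             simp flip: has_real_derivative_iff_has_vector_derivative)
  then show ?thesis
    unfolding poly_integral_def by (rule integral_unique)
qed

lemma poly_integral_by_parts:
  assumes "a \<le> b"
  shows "poly_integral a b (pderiv p * q)
    = poly (p * q) b - poly (p * q) a - poly_integral a b (p * pderiv q)"
  using poly_integral_pderiv[OF assms, of "p * q"]
  by (simp add: pderiv_mult poly_integral_add mult.commute)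

lemma poly_integral_nonneg:
  assumes "\<And>x. x \<in> {a..b} \<Longrightarrow> poly p x \<ge> 0"
  shows "poly_integral a b p \<ge> 0"
  unfolding poly_integral_def using assms by (intro integral_nonneg poly_integrable)

section \<open>Eigenpolynomials\<close>

definition eigenvalue :: "nat \<Rightarrow> real" where
  "eigenvalue n = (real n + 1) * (real n + 2)"

text \<open>The recursion expresses \<open>((1 - x\<^sup>2) y)'' = - (n + 1) (n + 2) y\<close> in powers of \<open>1 - x\<close>.\<close>

primrec jacobi_coeff :: "nat \<Rightarrow> nat \<Rightarrow> real" where
  "jacobi_coeff n 0 = 1"
| "jacobi_coeff n (Suc k) =
     - ((real n - real k) * (real n + real k + 3)) / (2 * (real k + 1) * (real k + 2))
     * jacobi_coeff n k"

definition jacobi :: "nat \<Rightarrow> real poly" where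
  "jacobi n = pcompose (\<Sum>k\<le>n. monom (jacobi_coeff n k) k) [:1, -1:]"

definition eigenpoly :: "nat \<Rightarrow> real poly" where
  "eigenpoly n = [:1, 0, -1:] * jacobi n"

lemma eigenvalue_pos: "eigenvalue n > 0"
  by (simp add: eigenvalue_def add_pos_nonneg)

lemma inj_eigenvalue: "inj eigenvalue"
proof (rule injI, rule ccontr)
  fix m n assume "eigenvalue m = eigenvalue n" "m \<noteq> n"
  moreover have "eigenvalue m - eigenvalue n = (real m - real n) * (real m + real n + 3)"
    by (simp add: eigenvalue_def algebra_simps)
  ultimately show False
    by (simp add: add_nonneg_eq_0_iff)
qed

lemma jacobi_coeff_eq_0: "n < k \<Longrightarrow> jacobi_coeff n k = 0"
proof (induction k)
  case (Suc k)
  then show ?case by (cases "k = n") auto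
qed simp

lemma jacobi_coeff_nonzero: "k \<le> n \<Longrightarrow> jacobi_coeff n k \<noteq> 0"
proof (induction k)
  case (Suc k)
  then show ?case by (simp add: add_nonneg_eq_0_iff add_eq_0_iff)
qed simp

lemma coeff_sum_jacobi_coeff: "coeff (\<Sum>k\<le>n. monom (jacobi_coeff n k) k) j = jacobi_coeff n j"
  by (simp add: coeff_sum jacobi_coeff_eq_0)

lemma degree_jacobi: "degree (jacobi n) = n"
proof -
  have "degree (\<Sum>k\<le>n. monom (jacobi_coeff n k) k) = n"
    by (intro antisym degree_le le_degree)
       (auto simp: coeff_sum_jacobi_coeff jacobi_coeff_eq_0 jacobi_coeff_nonzero)
  then show ?thesis
    by (simp add: jacobi_def degree_pcompose)
qed

lemma poly_jacobi_1: "poly (jacobi n) 1 = 1"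
  by (simp add: jacobi_def poly_pcompose poly_0_coeff_0 coeff_sum_jacobi_coeff)

lemma poly_eigenpoly: "poly (eigenpoly n) x = (1 - x\<^sup>2) * poly (jacobi n) x"
  by (simp add: eigenpoly_def power2_eq_square algebra_simps)

lemma poly_eigenpoly_boundary [simp]: "poly (eigenpoly n) 1 = 0" "poly (eigenpoly n) (-1) = 0"
  by (simp_all add: poly_eigenpoly)

lemma pderiv_eigenpoly:
  "pderiv (eigenpoly n) = [:1, 0, -1:] * pderiv (jacobi n) - [:0, 2:] * jacobi n"
  unfolding eigenpoly_def pderiv_mult by (simp add: pderiv_pCons)

lemma pderiv2_eigenpoly: "pderiv (pderiv (eigenpoly n)) = smult (- eigenvalue n) (jacobi n)"
proof -
  define Q where "Q = (\<Sum>k\<le>n. monom (jacobi_coeff n k) k)"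
  have "pderiv (pderiv ([:0, 2, -1:] * Q)) = smult (- eigenvalue n) Q"
  proof (rule poly_eqI)
    fix k
    have "coeff (pderiv (pderiv ([:0, 2, -1:] * Q))) k
        = 2 * (real k + 1) * (real k + 2) * jacobi_coeff n (Suc k)
          - (real k + 1) * (real k + 2) * jacobi_coeff n k"
      unfolding Q_def by (simp add: coeff_pderiv coeff_sum_jacobi_coeff algebra_simps)
    also have "2 * (real k + 1) * (real k + 2) * jacobi_coeff n (Suc k)
        = - ((real n - real k) * (real n + real k + 3)) * jacobi_coeff n k"
      by simp
    finally show "coeff (pderiv (pderiv ([:0, 2, -1:] * Q))) k = coeff (smult (- eigenvalue n) Q) k"
      unfolding Q_def by (simp add: coeff_sum_jacobi_coeff eigenvalue_def algebra_simps)
  qed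
  moreover have "eigenpoly n = pcompose ([:0, 2, -1:] * Q) [:1, -1:]"
    unfolding eigenpoly_def jacobi_def Q_def[symmetric] pcompose_mult by (simp add: pcompose_pCons)
  moreover have "jacobi n = pcompose Q [:1, -1:]"
    by (simp add: jacobi_def Q_def)
  ultimately show ?thesis
    by (simp add: pderiv_pcompose pderiv_mult pderiv_pCons pcompose_smult pderiv_smult pderiv_minus
        pcompose_uminus)
qed

lemma eigenpoly_jacobi_orthogonal:
  assumes "m \<noteq> n"
  shows "poly_integral (-1) 1 (eigenpoly m * jacobi n) = 0"
proof -
  let ?wronskian = "eigenpoly m * pderiv (eigenpoly n) - pderiv (eigenpoly m) * eigenpoly n"
  have "pderiv ?wronskian = smult (eigenvalue m) (jacobi m * eigenpoly n)
      - smult (eigenvalue n) (eigenpoly m * jacobi n)"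
    by (simp add: pderiv_diff pderiv_mult pderiv2_eigenpoly mult.commute)
  also have "jacobi m * eigenpoly n = eigenpoly m * jacobi n"
    unfolding eigenpoly_def by (simp only: mult_ac)
  finally have "pderiv ?wronskian = smult (eigenvalue m - eigenvalue n) (eigenpoly m * jacobi n)"
    by (simp add: smult_diff_left)
  then have "(eigenvalue m - eigenvalue n) * poly_integral (-1) 1 (eigenpoly m * jacobi n) = 0"
    using poly_integral_pderiv[of "-1" 1 ?wronskian] by (simp add: poly_integral_smult)
  then show ?thesis
    using assms inj_eigenvalue by (auto dest: injD)
qed

lemma poly_eq_sum_graded:
  fixes f :: "nat \<Rightarrow> 'a::field poly"
  assumes deg: "\<And>n. degree (f n) = n" and "f 0 \<noteq> 0"
  shows "degree q < N \<Longrightarrow> \<exists>a. q = (\<Sum>n<N. smult (a n) (f n))"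
proof (induction N arbitrary: q)
  case (Suc N)
  have lead: "coeff (f N) N \<noteq> 0"
    using deg[of N] \<open>f 0 \<noteq> 0\<close> by (metis leading_coeff_0_iff degree_0)
  define c where "c = coeff q N / coeff (f N) N"
  have "degree (q - smult c (f N)) \<le> N"
    using Suc.prems deg[of N]
    by (intro degree_diff_le) (auto intro: order_trans[OF degree_smult_le])
  moreover have "coeff (q - smult c (f N)) N = 0"
    using lead by (simp add: c_def)
  ultimately have "degree (q - smult c (f N)) < N \<or> q - smult c (f N) = 0"
    by (metis leading_coeff_0_iff le_neq_implies_less)
  then have "\<exists>a. q - smult c (f N) = (\<Sum>n<N. smult (a n) (f n))"
  proof
    assume "q - smult c (f N) = 0"
    then show ?thesis by (intro exI[of _ "\<lambda>_. 0"]) simp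
  qed (rule Suc.IH)
  then obtain a where "q - smult c (f N) = (\<Sum>n<N. smult (a n) (f n))" ..
  then have "q = (\<Sum>n<Suc N. smult ((a(N := c)) n) (f n))"
    by (simp add: diff_eq_eq)
  then show ?case by blast
qed simp

lemma eigenpoly_orthogonal_lower_degree:
  assumes "degree q < n"
  shows "poly_integral (-1) 1 (eigenpoly n * q) = 0"
proof -
  obtain a where "q = (\<Sum>m<n. smult (a m) (jacobi m))"
    using poly_eq_sum_graded[OF degree_jacobi _ assms] poly_jacobi_1[of 0] by fastforce
  then show ?thesis
    by (simp add: sum_distrib_left poly_integral_sum poly_integral_smult
        eigenpoly_jacobi_orthogonal)
qed

lemma pderiv_eigenpoly_orthogonal:
  assumes "degree q \<le> n"
  shows "poly_integral (-1) 1 (pderiv (eigenpoly n) * q) = 0"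
proof -
  have "poly_integral (-1) 1 (eigenpoly n * pderiv q) = 0"
  proof (cases "degree q = 0")
    case True
    then have "pderiv q = 0" by (simp add: pderiv_eq_0_iff)
    then show ?thesis by (simp add: poly_integral_def poly_0[abs_def])
  next
    case False
    then show ?thesis
      using assms by (intro eigenpoly_orthogonal_lower_degree) (simp add: degree_pderiv)
  qed
  then show ?thesis
    by (simp add: poly_integral_by_parts)
qed

text \<open>Up to a constant \<open>\<phi>\<^sub>n'\<close> is a Legendre polynomial \<open>P\<close> of degree \<open>n + 1\<close>, so that
  \<open>(x - c) P'\<close> is \<open>(n + 1) P\<close> up to terms orthogonal to \<open>P\<close>.  The choices \<open>c = -1\<close> and \<open>c = 1\<close>
  isolate one endpoint each.\<close>

lemma integral_pderiv_eigenpoly_square: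
  "(2 * real n + 3) * poly_integral (-1) 1 ((pderiv (eigenpoly n))\<^sup>2)
    = (1 - c) * (poly (pderiv (eigenpoly n)) 1)\<^sup>2 + (1 + c) * (poly (pderiv (eigenpoly n)) (-1))\<^sup>2"
proof -
  define P where "P = pderiv (eigenpoly n)"
  have degree_P: "degree P \<le> Suc n"
    unfolding P_def eigenpoly_def degree_pderiv
    by (rule order_trans[OF diff_le_mono[OF degree_mult_le]]) (simp add: degree_jacobi)
  define R where "R = [:-c, 1:] * pderiv P - smult (real n + 1) P"
  have "coeff R k = 0" if "k > n" for k
  proof (cases k)
    case (Suc j)
    then show ?thesis
      using that degree_P
      by (cases "j = n") (auto simp: R_def coeff_pderiv coeff_eq_0 algebra_simps)
  qed (use that in simp)
  then have R_orthogonal: "poly_integral (-1) 1 (P * R) = 0"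
    unfolding P_def by (intro pderiv_eigenpoly_orthogonal degree_le) auto
  have "pderiv ([:-c, 1:] * P\<^sup>2) = smult (2 * real n + 3) (P\<^sup>2) + smult 2 (P * R)"
    unfolding poly_eq_poly_eq_iff[symmetric] fun_eq_iff
    by (simp add: R_def pderiv_mult pderiv_pCons pderiv_diff pderiv_smult power2_eq_square
        algebra_simps)
  then have "(2 * real n + 3) * poly_integral (-1) 1 (P\<^sup>2)
      = poly ([:-c, 1:] * P\<^sup>2) 1 - poly ([:-c, 1:] * P\<^sup>2) (-1)"
    using poly_integral_pderiv[of "-1" 1 "[:-c, 1:] * P\<^sup>2"] R_orthogonal
    by (simp add: poly_integral_add poly_integral_smult)
  then show ?thesis
    by (simp add: P_def algebra_simps)
qed

lemma pderiv_eigenpoly_at_boundary: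
  "poly (pderiv (eigenpoly n)) 1 = -2" "(poly (pderiv (eigenpoly n)) (-1))\<^sup>2 = 4"
proof -
  show at_1: "poly (pderiv (eigenpoly n)) 1 = -2"
    by (simp add: pderiv_eigenpoly poly_jacobi_1)
  show "(poly (pderiv (eigenpoly n)) (-1))\<^sup>2 = 4"
    using integral_pderiv_eigenpoly_square[of n "-1"] integral_pderiv_eigenpoly_square[of n 1]
    by (simp add: at_1)
qed

definition jacobi_sqnorm :: "nat \<Rightarrow> real" where
  "jacobi_sqnorm n = poly_integral (-1) 1 (eigenpoly n * jacobi n)"

lemma jacobi_sqnorm_eq: "jacobi_sqnorm n = 8 / ((2 * real n + 3) * eigenvalue n)"
proof -
  have "poly_integral (-1) 1 ((pderiv (eigenpoly n))\<^sup>2) = eigenvalue n * jacobi_sqnorm n"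
    by (simp add: power2_eq_square poly_integral_by_parts pderiv2_eigenpoly poly_integral_smult
        jacobi_sqnorm_def flip: smult_minus_left)
  then have "(2 * real n + 3) * (eigenvalue n * jacobi_sqnorm n) = 8"
    using integral_pderiv_eigenpoly_square[of n "-1"] by (simp add: pderiv_eigenpoly_at_boundary)
  moreover have "(2 * real n + 3) * eigenvalue n \<noteq> 0"
    using eigenvalue_pos[of n] by (simp add: add_nonneg_eq_0_iff)
  ultimately show ?thesis
    by (metis (no_types) mult.assoc nonzero_mult_div_cancel_left)
qed

lemma jacobi_sqnorm_pos: "jacobi_sqnorm n > 0"
  by (simp add: jacobi_sqnorm_eq eigenvalue_pos add_nonneg_pos)

text \<open>The energy \<open>\<phi>'\<^sup>2 + \<mu> \<phi> \<psi>\<close> has derivative \<open>2 \<mu> x \<psi>\<^sup>2\<close>, so its maximum is attained at the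
  endpoints.\<close>

lemma eigenpoly_energy_le:
  assumes "x \<in> {-1..1}"
  shows "(poly (pderiv (eigenpoly n)) x)\<^sup>2 + eigenvalue n * ((1 - x\<^sup>2) * (poly (jacobi n) x)\<^sup>2) \<le> 4"
proof -
  define E where "E = (pderiv (eigenpoly n))\<^sup>2 + smult (eigenvalue n) (eigenpoly n * jacobi n)"
  have "poly (pderiv E) y = 2 * eigenvalue n * (poly (jacobi n) y)\<^sup>2 * y" for y
    unfolding E_def power2_eq_square pderiv_add pderiv_smult pderiv_mult pderiv2_eigenpoly
    by (simp add: pderiv_eigenpoly poly_eigenpoly power2_eq_square algebra_simps)
  then have E_DERIV:
    "(poly E has_real_derivative 2 * eigenvalue n * (poly (jacobi n) y)\<^sup>2 * y) (at y)" for y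
    by (metis poly_DERIV)
  have "poly E x \<le> 4"
  proof (cases "x \<ge> 0")
    case True
    have "poly E x \<le> poly E 1"
      by (rule deriv_nonneg_imp_mono[OF E_DERIV]) (use assms True eigenvalue_pos[of n] in auto)
    then show ?thesis by (simp add: E_def pderiv_eigenpoly_at_boundary)
  next
    case False
    have "poly E x \<le> poly E (-1)"
    proof (rule DERIV_nonpos_imp_nonincreasing[where f = "poly E"])
      fix y assume "-1 \<le> y" "y \<le> x"
      then have "2 * eigenvalue n * (poly (jacobi n) y)\<^sup>2 * y \<le> 0"
        using False eigenvalue_pos[of n] by (intro mult_nonneg_nonpos) auto
      then show "\<exists>D. (poly E has_real_derivative D) (at y) \<and> D \<le> 0"
        using E_DERIV by blast
    qed (use assms in simp)
    then show ?thesis by (simp add: E_def pderiv_eigenpoly_at_boundary)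
  qed
  then show ?thesis
    by (simp add: E_def poly_eigenpoly power2_eq_square mult.assoc)
qed

lemma abs_pderiv_eigenpoly_le:
  assumes "x \<in> {-1..1}"
  shows "\<bar>poly (pderiv (eigenpoly n)) x\<bar> \<le> 2"
proof -
  have "0 \<le> eigenvalue n * ((1 - x\<^sup>2) * (poly (jacobi n) x)\<^sup>2)"
    using assms abs_square_le_1[of x] eigenvalue_pos[of n] by auto
  then have "(poly (pderiv (eigenpoly n)) x)\<^sup>2 \<le> 2\<^sup>2"
    using eigenpoly_energy_le[OF assms, of n] by simp
  then show ?thesis
    using abs_le_square_iff[of "poly (pderiv (eigenpoly n)) x" 2] by simp
qed

lemma abs_eigenpoly_le_dist_boundary:
  assumes "x \<in> {-1..1}" and b: "b \<in> {-1, 1}"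
  shows "\<bar>poly (eigenpoly n) x\<bar> \<le> 2 * \<bar>x - b\<bar>"
proof -
  have "norm (poly (eigenpoly n) x - poly (eigenpoly n) b) \<le> 2 * norm (x - b)"
  proof (rule field_differentiable_bound[where S = "{-1..1}"
        and f' = "poly (pderiv (eigenpoly n))"])
    show "(poly (eigenpoly n) has_field_derivative poly (pderiv (eigenpoly n)) y)
        (at y within {-1..1})" for y
      by (rule has_field_derivative_at_within[OF poly_DERIV])
  qed (use assms abs_pderiv_eigenpoly_le in auto)
  then show ?thesis using b by auto
qed

lemma abs_eigenpoly_le: "x \<in> {-1..1} \<Longrightarrow> \<bar>poly (eigenpoly n) x\<bar> \<le> 2"
  using abs_eigenpoly_le_dist_boundary[of x 1 n] abs_eigenpoly_le_dist_boundary[of x "-1" n] by auto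

lemma abs_jacobi_le:
  assumes "x \<in> {-1..1}"
  shows "\<bar>poly (jacobi n) x\<bar> \<le> 2"
proof -
  define d where "d = 1 - \<bar>x\<bar>"
  have "1 - x\<^sup>2 = d * (1 + \<bar>x\<bar>)" by (simp add: d_def algebra_simps power2_eq_square)
  consider (right) "x = 1" | (left) "x = -1" | (inside) "d > 0"
    using assms by (fastforce simp: d_def)
  then show ?thesis
  proof cases
    case right
    then show ?thesis by (simp add: poly_jacobi_1)
  next
    case left
    then show ?thesis
      using abs_pderiv_eigenpoly_le[of "-1" n] by (simp add: pderiv_eigenpoly abs_mult)
  next
    case inside
    have "d * \<bar>poly (jacobi n) x\<bar> \<le> (d * (1 + \<bar>x\<bar>)) * \<bar>poly (jacobi n) x\<bar>"
      using inside by (intro mult_right_mono) auto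
    also have "\<dots> = \<bar>poly (eigenpoly n) x\<bar>"
      using inside by (simp add: poly_eigenpoly abs_mult \<open>1 - x\<^sup>2 = d * (1 + \<bar>x\<bar>)\<close>)
    also have "\<dots> \<le> d * 2"
      using abs_eigenpoly_le_dist_boundary[OF assms, of 1 n]
        abs_eigenpoly_le_dist_boundary[OF assms, of "-1" n] assms
      by (cases "x \<ge> 0") (auto simp: d_def)
    finally show ?thesis using inside by simp
  qed
qed

section \<open>Density of the eigenpolynomials\<close>

definition L2_approximable :: "((real \<Rightarrow> real) \<Rightarrow> bool) \<Rightarrow> (real \<Rightarrow> real) \<Rightarrow> bool" where
  "L2_approximable P f \<longleftrightarrow> (\<forall>e>0. \<exists>g. L2 g \<and> P g \<and> L2_dist f g < e)"

lemma L2_approximable_trans: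
  assumes "L2 f" "L2_approximable P f" and "\<And>g. L2 g \<Longrightarrow> P g \<Longrightarrow> L2_approximable Q g"
  shows "L2_approximable Q f"
  unfolding L2_approximable_def
proof (intro allI impI)
  fix e :: real assume "e > 0"
  then obtain g where g: "L2 g" "P g" "L2_dist f g < e / 2"
    using assms(2) unfolding L2_approximable_def by (meson half_gt_zero)
  then obtain h where h: "L2 h" "Q h" "L2_dist g h < e / 2"
    using assms(3)[OF g(1,2)] \<open>e > 0\<close> unfolding L2_approximable_def by (meson half_gt_zero)
  have "L2_dist f h < e"
    using L2_dist_triangle[OF assms(1) g(1) h(1)] g(3) h(3) by simp
  with h show "\<exists>g. L2 g \<and> Q g \<and> L2_dist f g < e" by blast
qed

lemma L2_approximable_by_limit:
  assumes "L2 f" "\<And>n. L2 (g n)" "\<And>n. P (g n)" "L2 w"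
    and "AE x in lborel. x \<in> Ioo11 \<longrightarrow> (\<lambda>n. g n x) \<longlonglongrightarrow> f x"
    and "\<And>n x. x \<in> Ioo11 \<Longrightarrow> \<bar>f x - g n x\<bar> \<le> \<bar>w x\<bar>"
  shows "L2_approximable P f"
  unfolding L2_approximable_def
proof (intro allI impI)
  fix e :: real assume "e > 0"
  from assms(5) have "AE x in lborel. x \<in> Ioo11 \<longrightarrow> (\<lambda>n. f x - g n x) \<longlonglongrightarrow> 0"
  proof eventually_elim
    case (elim x)
    then show ?case using tendsto_diff[OF tendsto_const, of "\<lambda>n. g n x" "f x" _ "f x"] by simp
  qed
  then have "AE x in lborel11. (\<lambda>n. f x - g n x) \<longlonglongrightarrow> 0"
    by (simp add: AE_restrict_space_iff)
  then have "(\<lambda>n. L2_dist f (g n)) \<longlonglongrightarrow> 0"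
    unfolding L2_dist_eq_L2_norm
    by (intro l2_norm_tendsto_zero[where w = w] borel_measurable_diff)
       (use assms L2_measurable in \<open>auto simp: L2_iff_square_integrable\<close>)
  from order_tendstoD(2)[OF this \<open>e > 0\<close>] obtain n where "L2_dist f (g n) < e"
    by (auto dest: eventually_happens)
  with assms show "\<exists>h. L2 h \<and> P h \<and> L2_dist f h < e" by blast
qed

definition clip :: "real \<Rightarrow> real \<Rightarrow> real" where
  "clip B y = max (- B) (min B y)"

lemma abs_clip_le: "B \<ge> 0 \<Longrightarrow> \<bar>clip B y\<bar> \<le> B"
  by (auto simp: clip_def)

lemma clip_id: "\<bar>y\<bar> \<le> B \<Longrightarrow> clip B y = y"
  by (auto simp: clip_def)

lemma continuous_on_clip: "continuous_on A f \<Longrightarrow> continuous_on A (\<lambda>x. clip B (f x))"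
  unfolding clip_def by (intro continuous_intros)

lemma L2_clip:
  assumes "L2 f" "B \<ge> 0"
  shows "L2 (\<lambda>x. clip B (f x))"
proof -
  note L2_measurable[OF assms(1), measurable]
  show ?thesis
    unfolding L2_iff_square_integrable
  proof (rule lborel11.square_integrable_bounded)
    show "(\<lambda>x. clip B (f x)) \<in> borel_measurable lborel11"
      unfolding clip_def by measurable
  qed (rule abs_clip_le[OF assms(2)])
qed

lemma L2_approximable_bounded:
  assumes "L2 f"
  shows "L2_approximable (\<lambda>g. \<exists>B\<ge>0. \<forall>x. \<bar>g x\<bar> \<le> B) f"
proof (rule L2_approximable_by_limit[where w = f and g = "\<lambda>n x. clip (real n) (f x)"])
  show "AE x in lborel. x \<in> Ioo11 \<longrightarrow> (\<lambda>n. clip (real n) (f x)) \<longlonglongrightarrow> f x"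
  proof (intro AE_I2 impI tendsto_eventually)
    fix x
    obtain N where "\<bar>f x\<bar> < real N" using reals_Archimedean2 by blast
    then show "\<forall>\<^sub>F n in sequentially. clip (real n) (f x) = f x"
      by (intro eventually_sequentiallyI[of N]) (simp add: clip_id)
  qed
  show "\<bar>f x - clip (real n) (f x)\<bar> \<le> \<bar>f x\<bar>" for n x
    by (auto simp: clip_def)
  show "\<exists>B\<ge>0. \<forall>x. \<bar>clip (real n) (f x)\<bar> \<le> B" for n
    by (intro exI[of _ "real n"]) (simp add: abs_clip_le)
qed (use assms L2_clip in auto)

lemma L2_approximable_continuous:
  assumes "L2 f" "B \<ge> 0" and fB: "\<And>x. \<bar>f x\<bar> \<le> B"
  shows "L2_approximable (continuous_on {-1..1}) f"
proof -
  have "(\<lambda>x. indicator Ioo11 x * f x) \<in> borel_measurable lebesgue"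
    using assms(1) by (intro measurable_completion) (simp add: L2_def set_borel_measurable_def)
  then have "(\<lambda>x. indicator Ioo11 x * f x) measurable_on UNIV"
    by (rule lebesgue_measurable_imp_measurable_on) simp
  then obtain N g where N: "negligible N" and g: "\<And>n. continuous_on UNIV (g n)"
    and lim: "\<And>x. x \<notin> N \<Longrightarrow> (\<lambda>n. g n x) \<longlonglongrightarrow> indicator Ioo11 x * f x"
    unfolding measurable_on_def by auto
  have cont: "continuous_on {-1..1} (\<lambda>x. clip B (g n x))" for n
    by (intro continuous_on_clip continuous_on_subset[OF g]) simp
  show ?thesis
  proof (rule L2_approximable_by_limit[where w = "\<lambda>_. 2 * B"])
    show "continuous_on {-1..1} (\<lambda>x. clip B (g n x))" "L2 (\<lambda>x. clip B (g n x))" for n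
      using cont L2_continuous by blast+
    show "L2 (\<lambda>_. 2 * B)" by (intro L2_continuous continuous_intros)
    show "\<bar>f x - clip B (g n x)\<bar> \<le> \<bar>2 * B\<bar>" for n x
      using fB[of x] abs_clip_le[OF assms(2), of "g n x"] by linarith
    have "AE x in lebesgue. x \<notin> N"
      using N by (auto simp: negligible_iff_null_sets intro: AE_not_in)
    then have "AE x in lborel. x \<notin> N" by (simp add: AE_completion_iff)
    then show "AE x in lborel. x \<in> Ioo11 \<longrightarrow> (\<lambda>n. clip B (g n x)) \<longlonglongrightarrow> f x"
    proof eventually_elim
      case (elim x)
      have "(\<lambda>n. clip B (g n x)) \<longlonglongrightarrow> clip B (f x)" if "x \<in> Ioo11"
        using lim[OF elim] that unfolding clip_def by (intro tendsto_intros) auto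
      then show ?case by (simp add: clip_id[OF fB])
    qed
  qed (rule assms(1))
qed

text \<open>Dividing by \<open>max (1 - x\<^sup>2) (1 / n)\<close> keeps the approximants continuous while making them vanish
  at the endpoints like \<open>1 - x\<^sup>2\<close>.\<close>

lemma L2_approximable_vanishing_at_boundary:
  assumes "continuous_on {-1..1} f"
  shows "L2_approximable (\<lambda>g. \<exists>q. continuous_on {-1..1} q \<and> g = (\<lambda>x. (1 - x\<^sup>2) * q x)) f"
proof -
  define q where "q n x = f x / max (1 - x\<^sup>2) (1 / real (Suc n))" for n x
  have pos: "max (1 - x\<^sup>2) (1 / real (Suc n)) > 0" for n and x :: real
    by (rule less_le_trans[OF _ max.cobounded2]) simp
  have cont: "continuous_on {-1..1} (q n)" for n
    unfolding q_def using pos by (intro continuous_intros assms) (simp add: less_imp_neq[symmetric])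
  show ?thesis
  proof (rule L2_approximable_by_limit[where w = f and g = "\<lambda>n x. (1 - x\<^sup>2) * q n x"])
    show "L2 f" "L2 (\<lambda>x. (1 - x\<^sup>2) * q n x)" for n
      by (intro L2_continuous continuous_intros assms cont)+
    show "\<exists>q'. continuous_on {-1..1} q' \<and> (\<lambda>x. (1 - x\<^sup>2) * q n x) = (\<lambda>x. (1 - x\<^sup>2) * q' x)" for n
      using cont by blast
    show "AE x in lborel. x \<in> Ioo11 \<longrightarrow> (\<lambda>n. (1 - x\<^sup>2) * q n x) \<longlonglongrightarrow> f x"
    proof (intro AE_I2 impI tendsto_eventually)
      fix x :: real assume "x \<in> Ioo11"
      then have x: "1 - x\<^sup>2 > 0" using abs_square_less_1[of x] by auto
      have "\<forall>\<^sub>F n in sequentially. 1 / real (Suc n) < 1 - x\<^sup>2"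
        by (rule order_tendstoD(2)[OF LIMSEQ_Suc[OF lim_1_over_n] x])
      then show "\<forall>\<^sub>F n in sequentially. (1 - x\<^sup>2) * q n x = f x"
        by eventually_elim (use x in \<open>auto simp: q_def max_def\<close>)
    qed
    show "\<bar>f x - (1 - x\<^sup>2) * q n x\<bar> \<le> \<bar>f x\<bar>" if "x \<in> Ioo11" for n x
    proof -
      define \<theta> where "\<theta> = (1 - x\<^sup>2) / max (1 - x\<^sup>2) (1 / real (Suc n))"
      have "0 \<le> 1 - x\<^sup>2" using that abs_square_le_1[of x] by auto
      then have "0 \<le> \<theta>" "\<theta> \<le> 1"
        using pos[of x n] by (auto simp: \<theta>_def divide_le_eq)
      moreover have "f x - (1 - x\<^sup>2) * q n x = (1 - \<theta>) * f x"
        by (simp add: \<theta>_def q_def left_diff_distrib)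
      ultimately show ?thesis
        by (simp add: abs_mult mult_left_le_one_le)
    qed
  qed (intro L2_continuous assms)
qed

definition eigenpoly_sum :: "nat \<Rightarrow> (nat \<Rightarrow> real) \<Rightarrow> real poly" where
  "eigenpoly_sum N a = (\<Sum>n<N. smult (a n) (eigenpoly n))"

lemma L2_poly: "L2 (poly p)"
  by (intro L2_continuous continuous_intros)

lemma eigenpoly_sum_eq_weight_times:
  "\<exists>N a. eigenpoly_sum N a = [:1, 0, -1:] * p"
proof -
  have "jacobi 0 \<noteq> 0"
    using poly_jacobi_1[of 0] by auto
  then obtain a where "p = (\<Sum>n<Suc (degree p). smult (a n) (jacobi n))"
    using poly_eq_sum_graded[OF degree_jacobi _ lessI] by blast
  then have "[:1, 0, -1:] * p = [:1, 0, -1:] * (\<Sum>n<Suc (degree p). smult (a n) (jacobi n))"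
    by simp
  also have "\<dots> = eigenpoly_sum (Suc (degree p)) a"
    unfolding eigenpoly_sum_def eigenpoly_def sum_distrib_left mult_smult_right ..
  finally show ?thesis by metis
qed

lemma L2_approximable_eigenpoly_sum_of_weight_times:
  assumes "continuous_on {-1..1} q"
  shows "L2_approximable (\<lambda>g. \<exists>N a. g = poly (eigenpoly_sum N a)) (\<lambda>x. (1 - x\<^sup>2) * q x)"
  unfolding L2_approximable_def
proof (intro allI impI)
  fix e :: real assume e: "e > 0"
  obtain r where r: "real_polynomial_function r" "\<And>x. x \<in> {-1..1} \<Longrightarrow> \<bar>q x - r x\<bar> < e / 2"
    using Stone_Weierstrass_real_polynomial_function[OF _ assms, of "e / 2"] e compact_Icc
    by (metis half_gt_zero)
  obtain b m where "r = (\<lambda>x. \<Sum>i\<le>m. b i * x ^ i)"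
    using r(1) unfolding real_polynomial_function_iff_sum by blast
  then have r_eq_poly: "r x = poly (\<Sum>i\<le>m. monom (b i) i) x" for x
    by (simp add: poly_sum poly_monom)
  obtain N a where "eigenpoly_sum N a = [:1, 0, -1:] * (\<Sum>i\<le>m. monom (b i) i)"
    using eigenpoly_sum_eq_weight_times by blast
  then have eigenpoly_sum_eq: "poly (eigenpoly_sum N a) x = (1 - x\<^sup>2) * r x" for x
    by (simp add: r_eq_poly power2_eq_square algebra_simps)
  have "L2_dist (\<lambda>x. (1 - x\<^sup>2) * q x) (poly (eigenpoly_sum N a)) \<le> sqrt 2 * (e / 2)"
    unfolding L2_dist_eq_L2_norm
  proof (rule L2_norm_bounded)
    show "L2 (\<lambda>x. (1 - x\<^sup>2) * q x - poly (eigenpoly_sum N a) x)"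
      by (intro L2_continuous continuous_intros assms)
    fix x assume "x \<in> Ioo11"
    then have x: "0 \<le> 1 - x\<^sup>2" "1 - x\<^sup>2 \<le> 1" "x \<in> {-1..1}"
      using abs_square_le_1[of x] by auto
    have "\<bar>(1 - x\<^sup>2) * (q x - r x)\<bar> \<le> 1 * (e / 2)"
      unfolding abs_mult using r(2)[OF x(3)] x by (intro mult_mono) auto
    then show "\<bar>(1 - x\<^sup>2) * q x - poly (eigenpoly_sum N a) x\<bar> \<le> e / 2"
      by (simp add: eigenpoly_sum_eq right_diff_distrib)
  qed (use e in simp)
  also have "\<dots> < e"
    using e real_sqrt_less_mono[of 2 4] by (simp add: field_simps)
  finally show "\<exists>g. L2 g \<and> (\<exists>N a. g = poly (eigenpoly_sum N a))
      \<and> L2_dist (\<lambda>x. (1 - x\<^sup>2) * q x) g < e"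
    using L2_poly by blast
qed

lemma L2_approximable_eigenpoly_sum:
  assumes "L2 f"
  shows "L2_approximable (\<lambda>g. \<exists>N a. g = poly (eigenpoly_sum N a)) f"
proof -
  let ?P = "\<lambda>g. \<exists>N a. g = poly (eigenpoly_sum N a)"
  have continuous: "L2_approximable ?P g" if g: "L2 g" "continuous_on {-1..1} g" for g
  proof (rule L2_approximable_trans[OF g(1) L2_approximable_vanishing_at_boundary[OF g(2)]])
    show "L2_approximable ?P h" if "\<exists>q. continuous_on {-1..1} q \<and> h = (\<lambda>x. (1 - x\<^sup>2) * q x)" for h
      using that L2_approximable_eigenpoly_sum_of_weight_times by auto
  qed
  show ?thesis
  proof (rule L2_approximable_trans[OF assms L2_approximable_bounded[OF assms]])
    show "L2_approximable ?P g" if g: "L2 g" "\<exists>B\<ge>0. \<forall>x. \<bar>g x\<bar> \<le> B" for g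
    proof -
      from g(2) obtain B where B: "B \<ge> 0" "\<And>x. \<bar>g x\<bar> \<le> B" by blast
      show ?thesis
        by (rule L2_approximable_trans[OF g(1) L2_approximable_continuous[OF g(1) B] continuous])
    qed
  qed
qed

section \<open>The evolution\<close>

definition mode_coeff :: "(real \<Rightarrow> real) \<Rightarrow> nat \<Rightarrow> real" where
  "mode_coeff v n = (LINT x:Ioo11|lborel. v x * poly (jacobi n) x) / jacobi_sqnorm n"

lemma integrable_mult_poly: "L2 v \<Longrightarrow> integrable lborel11 (\<lambda>x. v x * poly p x)"
  using square_integrable_mult[of lborel11 v "poly p"] L2_poly[of p]
  by (simp add: L2_iff_square_integrable)

lemma mode_coeff_diff:
  assumes "L2 u" "L2 v"
  shows "mode_coeff (\<lambda>x. u x - v x) n = mode_coeff u n - mode_coeff v n"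
  using assms[THEN integrable_mult_poly]
  by (simp add: mode_coeff_def LINT_lborel11 left_diff_distrib diff_divide_distrib)

lemma abs_mode_coeff_le:
  assumes "L2 v"
  shows "\<bar>mode_coeff v n\<bar> \<le> L2_norm v * (2 * sqrt 2 / jacobi_sqnorm n)"
proof -
  have "L2_norm (poly (jacobi n)) \<le> sqrt 2 * 2"
    by (intro L2_norm_bounded L2_poly abs_jacobi_le) auto
  then have "L2_norm v * L2_norm (poly (jacobi n)) \<le> L2_norm v * (2 * sqrt 2)"
    by (intro mult_left_mono l2_norm_nonneg) (simp add: mult.commute)
  moreover have "\<bar>LINT x|lborel11. v x * poly (jacobi n) x\<bar> \<le> L2_norm v * L2_norm (poly (jacobi n))"
    using assms L2_poly by (intro Cauchy_Schwarz_integral) (simp_all add: L2_iff_square_integrable)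
  ultimately show ?thesis
    using jacobi_sqnorm_pos[of n]
    by (simp add: mode_coeff_def LINT_lborel11 divide_right_mono)
qed

lemma mode_coeff_eigenpoly_sum:
  "mode_coeff (poly (eigenpoly_sum N a)) m = (if m < N then a m else 0)"
proof -
  have "(LINT x:Ioo11|lborel. poly (eigenpoly_sum N a) x * poly (jacobi m) x)
      = poly_integral (-1) 1 (eigenpoly_sum N a * jacobi m)"
    by (simp add: poly_integral_def poly_mult[abs_def] LINT_Ioo_continuous continuous_intros)
  also have "\<dots> = (\<Sum>n<N. a n * poly_integral (-1) 1 (eigenpoly n * jacobi m))"
    by (simp add: eigenpoly_sum_def sum_distrib_right poly_integral_sum poly_integral_smult)
  also have "\<dots> = (\<Sum>n<N. if n = m then a m * jacobi_sqnorm m else 0)"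
    by (intro sum.cong) (auto simp: eigenpoly_jacobi_orthogonal jacobi_sqnorm_def)
  finally show ?thesis
    using jacobi_sqnorm_pos[of m] by (simp add: mode_coeff_def)
qed

lemma poly_eigenpoly_sum_boundary [simp]:
  "poly (eigenpoly_sum N a) 1 = 0" "poly (eigenpoly_sum N a) (-1) = 0"
  by (simp_all add: eigenpoly_sum_def poly_sum)

lemma poly_eigenpoly_sum: "poly (eigenpoly_sum N a) x = (\<Sum>n<N. a n * poly (eigenpoly n) x)"
  by (simp add: eigenpoly_sum_def poly_sum)

lemma weight_pderiv2_eigenpoly_sum:
  "[:1, 0, -1:] * pderiv (pderiv (eigenpoly_sum N a)) = eigenpoly_sum N (\<lambda>n. - eigenvalue n * a n)"
proof -
  have "pderiv (pderiv (eigenpoly_sum N a)) = (\<Sum>n<N. smult (- eigenvalue n * a n) (jacobi n))"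
    using higher_pderiv_sum[of 2 "\<lambda>n. smult (a n) (eigenpoly n)" "{..<N}"]
    by (simp add: eigenpoly_sum_def numeral_2_eq_2 pderiv_smult pderiv2_eigenpoly mult.commute)
  then show ?thesis
    unfolding eigenpoly_sum_def eigenpoly_def by (simp only: sum_distrib_left mult_smult_right)
qed

lemma poly_integral_weight_pderiv2_nonpos:
  assumes "poly U 1 = 0" "poly U (-1) = 0"
  shows "poly_integral (-1) 1 (U * ([:1, 0, -1:] * pderiv (pderiv U))) \<le> 0"
proof -
  define R where "R = [:1, 0, -1:] * (pderiv U)\<^sup>2 + U\<^sup>2"
  have "pderiv ([:1, 0, -1:] * U * pderiv U + [:0, 1:] * U\<^sup>2)
      = U * ([:1, 0, -1:] * pderiv (pderiv U)) + R"
    unfolding poly_eq_poly_eq_iff[symmetric] fun_eq_iff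
      R_def power2_eq_square pderiv_add pderiv_mult
    by (simp add: pderiv_pCons algebra_simps)
  then have "poly_integral (-1) 1 (U * ([:1, 0, -1:] * pderiv (pderiv U)))
      = - poly_integral (-1) 1 R"
    using poly_integral_pderiv[of "-1" 1 "[:1, 0, -1:] * U * pderiv U + [:0, 1:] * U\<^sup>2"] assms
    by (simp add: poly_integral_add)
  moreover have "poly R x \<ge> 0" if "x \<in> {-1..1}" for x
  proof -
    have "poly R x = (1 - x\<^sup>2) * (poly (pderiv U) x)\<^sup>2 + (poly U x)\<^sup>2"
      by (simp add: R_def power2_eq_square algebra_simps)
    then show ?thesis using that abs_square_le_1[of x] by auto
  qed
  ultimately show ?thesis
    using poly_integral_nonneg[of "-1" 1 R] by simp
qed

lemma L2_norm_poly: "L2_norm (poly p) = sqrt (poly_integral (-1) 1 (p\<^sup>2))"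
  by (simp add: l2_norm_def poly_integral_def poly_power[abs_def] LINT_Ioo_continuous
      continuous_intros flip: LINT_lborel11)

locale heat_flow =
  fixes lam :: real
  assumes lam_pos: "lam > 0"
begin

definition rate :: "nat \<Rightarrow> real" where
  "rate n = lam / 2 * eigenvalue n"

sublocale decay_rates rate
proof
  show "rate n \<ge> 0" for n
    using lam_pos eigenvalue_pos[of n] by (simp add: rate_def)
  fix t :: real assume t: "t > 0"
  show "summable (\<lambda>n. exp (- (rate n * t)))"
  proof (rule summable_comparison_test')
    show "summable (\<lambda>n. exp (- (lam * t)) ^ n)"
      using lam_pos t by (intro summable_geometric) simp
    fix n
    have "lam * t * real n \<le> lam * t * (eigenvalue n / 2)"
      using lam_pos t by (intro mult_left_mono) (auto simp: eigenvalue_def field_simps)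
    then show "norm (exp (- (rate n * t))) \<le> exp (- (lam * t)) ^ n"
      by (simp add: rate_def mult_ac flip: exp_of_nat_mult)
  qed
qed

definition evol :: "(real \<Rightarrow> real) \<Rightarrow> real \<Rightarrow> real \<Rightarrow> real" where
  "evol v = mode_series (\<lambda>n x. mode_coeff v n * poly (eigenpoly n) x)"

definition evol_x :: "(real \<Rightarrow> real) \<Rightarrow> real \<Rightarrow> real \<Rightarrow> real" where
  "evol_x v = mode_series (\<lambda>n x. mode_coeff v n * poly (pderiv (eigenpoly n)) x)"

definition evol_xx :: "(real \<Rightarrow> real) \<Rightarrow> real \<Rightarrow> real \<Rightarrow> real" where
  "evol_xx v = mode_series (\<lambda>n x. mode_coeff v n * poly (pderiv (pderiv (eigenpoly n))) x)"

lemma tempered_inverse_jacobi_sqnorm: "tempered S (\<lambda>n x. 1 / jacobi_sqnorm n)"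
proof (rule tempered_mono)
  show "tempered S (\<lambda>n x. 1 / lam\<^sup>2 * (rate n * rate n))"
    by (intro tempered_cmult tempered_mult tempered_rate)
  fix n
  have "1 / jacobi_sqnorm n = (2 * real n + 3) * eigenvalue n / 8"
    by (simp add: jacobi_sqnorm_eq)
  also have "\<dots> \<le> (2 * eigenvalue n) * eigenvalue n / 8"
    using eigenvalue_pos[of n]
    by (intro divide_right_mono mult_right_mono) (auto simp: eigenvalue_def algebra_simps)
  also have "\<dots> = 1 / lam\<^sup>2 * (rate n * rate n)"
    using lam_pos by (simp add: rate_def power2_eq_square)
  finally show "\<bar>1 / jacobi_sqnorm n\<bar> \<le> \<bar>1 / lam\<^sup>2 * (rate n * rate n)\<bar>"
    using jacobi_sqnorm_pos[of n] by simp
qed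

lemma tempered_mode_coeff:
  assumes "L2 v"
  shows "tempered S (\<lambda>n x. mode_coeff v n)"
proof (rule tempered_mono)
  show "tempered S (\<lambda>n x. (L2_norm v * (2 * sqrt 2)) * (1 / jacobi_sqnorm n))"
    by (intro tempered_cmult tempered_inverse_jacobi_sqnorm)
  show "\<bar>mode_coeff v n\<bar> \<le> \<bar>L2_norm v * (2 * sqrt 2) * (1 / jacobi_sqnorm n)\<bar>" for n
    using order_trans[OF abs_mode_coeff_le[OF assms, of n] abs_ge_self] by simp
qed

lemma tempered_evol:
  assumes "L2 v"
  shows "tempered {-1..1} (\<lambda>n x. mode_coeff v n * poly (eigenpoly n) x)"
    and "tempered {-1..1} (\<lambda>n x. mode_coeff v n * poly (pderiv (eigenpoly n)) x)"
    and "tempered {-1..1} (\<lambda>n x. mode_coeff v n * poly (pderiv (pderiv (eigenpoly n))) x)"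
proof -
  show "tempered {-1..1} (\<lambda>n x. mode_coeff v n * poly (eigenpoly n) x)"
    "tempered {-1..1} (\<lambda>n x. mode_coeff v n * poly (pderiv (eigenpoly n)) x)"
    by (intro tempered_mult tempered_mode_coeff assms tempered_bounded[where B = 2];
        simp add: abs_eigenpoly_le abs_pderiv_eigenpoly_le)+
  have "tempered {-1..1} (\<lambda>n x. mode_coeff v n * (- (2 / lam) * (rate n * poly (jacobi n) x)))"
    by (intro tempered_mult tempered_cmult tempered_rate tempered_mode_coeff assms
        tempered_bounded[where B = 2] abs_jacobi_le)
  then show "tempered {-1..1} (\<lambda>n x. mode_coeff v n * poly (pderiv (pderiv (eigenpoly n))) x)"
    using lam_pos by (simp add: pderiv2_eigenpoly rate_def)
qed

lemma continuous_evol: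
  assumes "L2 v"
  shows "continuous_up_to_boundary (evol v)" "continuous_up_to_boundary (evol_x v)"
    "continuous_up_to_boundary (evol_xx v)"
  unfolding evol_def evol_x_def evol_xx_def
  by (intro mode_series_continuous_on tempered_evol[OF assms] continuous_intros)+

lemma evol_DERIV_x:
  assumes "L2 v" "x \<in> Ioo11" "t > 0"
  shows "((\<lambda>x. evol v x t) has_real_derivative evol_x v x t) (at x)"
    and "((\<lambda>x. evol_x v x t) has_real_derivative evol_xx v x t) (at x)"
  unfolding evol_def evol_x_def evol_xx_def using assms(2)
  by (intro mode_series_DERIV_x[where S = "{-1..1}"] tempered_evol[OF assms(1)] assms(3)
      DERIV_cmult has_field_derivative_at_within[OF poly_DERIV]; simp)+

lemma evol_DERIV_t:
  assumes "L2 v" "x \<in> {-1..1}" "t > 0"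
  shows "((\<lambda>t. evol v x t) has_real_derivative lam / 2 * (1 - x\<^sup>2) * evol_xx v x t) (at t)"
proof -
  have "((\<lambda>t. evol v x t) has_real_derivative
      mode_series (\<lambda>n x. - rate n * (mode_coeff v n * poly (eigenpoly n) x)) x t) (at t)"
    unfolding evol_def by (rule mode_series_DERIV_t[OF tempered_evol(1)[OF assms(1)] assms(2,3)])
  also have "mode_series (\<lambda>n x. - rate n * (mode_coeff v n * poly (eigenpoly n) x)) x t
      = mode_series (\<lambda>n x. (lam / 2 * (1 - x\<^sup>2))
          * (mode_coeff v n * poly (pderiv (pderiv (eigenpoly n))) x)) x t"
    unfolding mode_series_def by (simp add: rate_def pderiv2_eigenpoly poly_eigenpoly mult_ac)
  also have "\<dots> = lam / 2 * (1 - x\<^sup>2) * evol_xx v x t"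
    unfolding evol_xx_def
    by (rule mode_series_cmult[OF assms(3) tempered_evol(3)[OF assms(1)] assms(2)])
  finally show ?thesis .
qed

lemma evol_boundary [simp]: "evol v 1 t = 0" "evol v (-1) t = 0"
  by (simp_all add: evol_def mode_series_def)

lemma L2_evol: "L2 v \<Longrightarrow> t > 0 \<Longrightarrow> L2 (\<lambda>x. evol v x t)"
  by (rule L2_continuous[OF continuous_on_slice[OF continuous_evol(1)]])

lemma evol_diff:
  assumes "L2 u" "L2 v" "t > 0" "x \<in> {-1..1}"
  shows "evol (\<lambda>x. u x - v x) x t = evol u x t - evol v x t"
  unfolding evol_def mode_coeff_diff[OF assms(1,2)] left_diff_distrib
  by (intro mode_series_diff[where S = "{-1..1}"] tempered_evol(1) assms)

lemma evol_sup_bound: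
  assumes t: "t > 0"
  shows "\<exists>K\<ge>0. \<forall>v. L2 v \<longrightarrow> (\<forall>x\<in>{-1..1}. \<bar>evol v x t\<bar> \<le> K * L2_norm v)"
proof -
  define K where "K = mode_series (\<lambda>n _. 4 * sqrt 2 * (1 / jacobi_sqnorm n)) () t"
  have "\<bar>evol v x t\<bar> \<le> \<bar>K\<bar> * L2_norm v" if v: "L2 v" and x: "x \<in> {-1..1}" for v x
  proof -
    have tempered: "tempered {()} (\<lambda>n _. 4 * sqrt 2 * (1 / jacobi_sqnorm n))"
      by (intro tempered_cmult tempered_inverse_jacobi_sqnorm)
    have "\<bar>evol v x t\<bar>
        \<le> mode_series (\<lambda>n _. L2_norm v * (4 * sqrt 2 * (1 / jacobi_sqnorm n))) () t"
      unfolding evol_def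
    proof (rule abs_mode_series_le[OF t tempered_cmult[OF tempered]])
      fix n
      have "0 \<le> L2_norm v * (2 * sqrt 2 / jacobi_sqnorm n)"
        by (rule order_trans[OF abs_ge_zero abs_mode_coeff_le[OF v]])
      then have "\<bar>mode_coeff v n\<bar> * \<bar>poly (eigenpoly n) x\<bar>
          \<le> (L2_norm v * (2 * sqrt 2 / jacobi_sqnorm n)) * 2"
        by (intro mult_mono abs_mode_coeff_le[OF v] abs_eigenpoly_le[OF x]) auto
      then show "\<bar>mode_coeff v n * poly (eigenpoly n) x\<bar>
          \<le> L2_norm v * (4 * sqrt 2 * (1 / jacobi_sqnorm n))"
        by (simp add: abs_mult mult_ac)
    qed simp
    also have "\<dots> = L2_norm v * K"
      unfolding K_def by (rule mode_series_cmult[OF t tempered]) simp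
    also have "\<dots> \<le> \<bar>K\<bar> * L2_norm v"
      using mult_right_mono[OF abs_ge_self l2_norm_nonneg] by (simp add: mult.commute)
    finally show ?thesis .
  qed
  then show ?thesis by (intro exI[of _ "\<bar>K\<bar>"]) auto
qed

lemma L2_norm_evol_bounded:
  assumes "t > 0"
  shows "\<exists>K\<ge>0. \<forall>v. L2 v \<longrightarrow> L2_norm (\<lambda>x. evol v x t) \<le> K * L2_norm v"
proof -
  obtain K where K: "K \<ge> 0" "\<And>v x. L2 v \<Longrightarrow> x \<in> {-1..1} \<Longrightarrow> \<bar>evol v x t\<bar> \<le> K * L2_norm v"
    using evol_sup_bound[OF assms] by blast
  have "L2_norm (\<lambda>x. evol v x t) \<le> sqrt 2 * (K * L2_norm v)" if "L2 v" for v
    using that K(1)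
    by (intro L2_norm_bounded L2_evol assms K(2) mult_nonneg_nonneg l2_norm_nonneg) auto
  then show ?thesis
    using K(1) by (intro exI[of _ "sqrt 2 * K"]) (simp add: mult.assoc)
qed

definition heat_poly :: "nat \<Rightarrow> (nat \<Rightarrow> real) \<Rightarrow> real \<Rightarrow> real poly" where
  "heat_poly N a t = eigenpoly_sum N (\<lambda>n. exp (- (rate n * t)) * a n)"

lemma heat_poly_0: "heat_poly N a 0 = eigenpoly_sum N a"
  by (simp add: heat_poly_def)

lemma evol_eigenpoly_sum: "evol (poly (eigenpoly_sum N a)) x t = poly (heat_poly N a t) x"
proof -
  have "evol (poly (eigenpoly_sum N a)) x t
      = (\<Sum>n\<in>{..<N}. exp (- (rate n * t)) * (a n * poly (eigenpoly n) x))"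
    unfolding evol_def mode_series_def mode_coeff_eigenpoly_sum
    by (subst suminf_finite[of "{..<N}"]) auto
  then show ?thesis
    by (simp add: heat_poly_def poly_eigenpoly_sum mult.assoc)
qed

lemma continuous_heat_poly: "continuous_on A (\<lambda>(t, x). poly (heat_poly N a t) x)"
  unfolding heat_poly_def poly_eigenpoly_sum split_beta by (intro continuous_intros)

lemma weight_pderiv2_heat_poly:
  "[:1, 0, -1:] * pderiv (pderiv (heat_poly N a t)) = heat_poly N (\<lambda>n. - eigenvalue n * a n) t"
  unfolding heat_poly_def weight_pderiv2_eigenpoly_sum by (simp add: mult.left_commute)

lemma heat_poly_DERIV_t:
  "((\<lambda>t. poly (heat_poly N a t) x) has_real_derivative
     lam / 2 * poly ([:1, 0, -1:] * pderiv (pderiv (heat_poly N a t))) x) (at t)"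
  unfolding weight_pderiv2_heat_poly unfolding heat_poly_def poly_eigenpoly_sum sum_distrib_left
  by (auto intro!: derivative_eq_intros sum.cong simp: rate_def)

lemma L2_norm_heat_poly_le:
  assumes "t \<ge> 0"
  shows "L2_norm (poly (heat_poly N a t)) \<le> L2_norm (poly (heat_poly N a 0))"
proof -
  define U where "U = heat_poly N a"
  define energy where "energy s = poly_integral (-1) 1 ((U s)\<^sup>2)" for s
  define dissipation where
    "dissipation s = smult lam (U s * ([:1, 0, -1:] * pderiv (pderiv (U s))))" for s
  have "(energy has_real_derivative poly_integral (-1) 1 (dissipation s)) (at s)" for s
    unfolding energy_def poly_integral_def cbox_interval[symmetric]
  proof (rule leibniz_rule_field_derivative[where U = UNIV])
    show "((\<lambda>s. poly ((U s)\<^sup>2) x) has_real_derivative poly (dissipation s) x)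
        (at s within UNIV)" for s x
      unfolding poly_power dissipation_def U_def
      by (auto intro!: derivative_eq_intros heat_poly_DERIV_t)
    show "continuous_on (UNIV \<times> cbox (-1) 1) (\<lambda>(s, x). poly (dissipation s) x)"
      unfolding dissipation_def U_def weight_pderiv2_heat_poly poly_smult poly_mult split_beta
      by (intro continuous_intros continuous_heat_poly[unfolded split_beta])
  qed (auto simp: poly_integrable simp del: poly_power)
  moreover have "poly_integral (-1) 1 (dissipation s) \<le> 0" for s
    unfolding dissipation_def poly_integral_smult using lam_pos
    by (intro mult_nonneg_nonpos poly_integral_weight_pderiv2_nonpos)
       (auto simp: U_def heat_poly_def)
  ultimately have "energy t \<le> energy 0"
    using DERIV_nonpos_imp_nonincreasing[OF assms, of energy] by blast
  then show ?thesis
    by (simp add: L2_norm_poly energy_def U_def)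
qed

lemma L2_norm_evol_le:
  assumes v: "L2 v" and t: "t > 0"
  shows "L2_norm (\<lambda>x. evol v x t) \<le> L2_norm v"
proof (rule field_le_epsilon)
  fix e :: real assume e: "e > 0"
  obtain K where K: "K \<ge> 0" "\<And>v. L2 v \<Longrightarrow> L2_norm (\<lambda>x. evol v x t) \<le> K * L2_norm v"
    using L2_norm_evol_bounded[OF t] by blast
  obtain N a where w: "L2_dist v (poly (heat_poly N a 0)) < e / (K + 1)"
    using L2_approximable_eigenpoly_sum[OF v] e K(1) unfolding L2_approximable_def heat_poly_0
    by (metis add_nonneg_pos divide_pos_pos zero_less_one)
  let ?w = "poly (heat_poly N a 0)"
  let ?r = "\<lambda>x. v x - ?w x"
  have r: "L2 ?r" "L2_norm ?r < e / (K + 1)"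
    using w v by (auto simp: L2_diff L2_poly L2_dist_eq_L2_norm)
  have "L2_norm (\<lambda>x. evol v x t) = L2_norm (\<lambda>x. evol ?r x t + poly (heat_poly N a t) x)"
    by (intro l2_norm_cong) (simp add: evol_diff v L2_poly t heat_poly_0 evol_eigenpoly_sum)
  also have "\<dots> \<le> L2_norm (\<lambda>x. evol ?r x t) + L2_norm (poly (heat_poly N a t))"
    by (intro L2_norm_triangle L2_evol[OF r(1) t] L2_poly)
  also have "\<dots> \<le> K * L2_norm ?r + L2_norm ?w"
    using K(2)[OF r(1)] L2_norm_heat_poly_le t by (intro add_mono) auto
  also have "L2_norm ?w \<le> L2_norm ?r + L2_norm v"
    using L2_norm_triangle[of "\<lambda>x. ?w x - v x" v] v L2_dist_commute[of v ?w]
    by (simp add: L2_diff L2_poly L2_dist_eq_L2_norm)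
  also have "K * L2_norm ?r + (L2_norm ?r + L2_norm v) = (K + 1) * L2_norm ?r + L2_norm v"
    by (simp add: algebra_simps)
  also have "(K + 1) * L2_norm ?r \<le> e"
    using r(2) K(1) by (simp add: pos_less_divide_eq mult.commute)
  finally show "L2_norm (\<lambda>x. evol v x t) \<le> L2_norm v + e"
    by simp
qed

lemma L2_dist_heat_poly_tendsto:
  "((\<lambda>t. L2_dist (poly (heat_poly N a t)) (poly (heat_poly N a 0))) \<longlongrightarrow> 0) (at_right 0)"
proof -
  have "continuous_on (UNIV \<times> cbox (-1) 1)
      (\<lambda>(t, x). (poly (heat_poly N a t) x - poly (heat_poly N a 0) x)\<^sup>2)"
    using continuous_heat_poly unfolding split_beta by (intro continuous_intros)
  then have "continuous_on UNIV (\<lambda>t. sqrt (integral (cbox (-1) 1)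
      (\<lambda>x. (poly (heat_poly N a t) x - poly (heat_poly N a 0) x)\<^sup>2)))"
    by (intro continuous_intros integral_continuous_on_param)
  then have "continuous_on UNIV (\<lambda>t. L2_dist (poly (heat_poly N a t)) (poly (heat_poly N a 0)))"
    by (simp add: L2_dist_continuous continuous_intros)
  then have "((\<lambda>t. L2_dist (poly (heat_poly N a t)) (poly (heat_poly N a 0)))
      \<longlongrightarrow> L2_dist (poly (heat_poly N a 0)) (poly (heat_poly N a 0))) (at 0)"
    unfolding continuous_on_def by blast
  then show ?thesis
    by (simp add: L2_dist_def filterlim_at_split)
qed

lemma L2_dist_evol_tendsto_initial:
  assumes v: "L2 v"
  shows "((\<lambda>t. L2_dist (\<lambda>x. evol v x t) v) \<longlongrightarrow> 0) (at_right 0)"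
proof (rule order_tendstoI)
  fix e :: real assume "e < 0"
  then show "\<forall>\<^sub>F t in at_right 0. e < L2_dist (\<lambda>x. evol v x t) v"
    using L2_dist_nonneg less_le_trans by (intro always_eventually) blast
next
  fix e :: real assume "e > 0"
  then obtain N a where w: "L2_dist v (poly (heat_poly N a 0)) < e / 3"
    using L2_approximable_eigenpoly_sum[OF v] unfolding L2_approximable_def heat_poly_0
    by (metis divide_pos_pos zero_less_numeral)
  let ?w = "\<lambda>t. poly (heat_poly N a t)"
  have "\<forall>\<^sub>F t in at_right 0. L2_dist (?w t) (?w 0) < e / 3"
    using \<open>e > 0\<close> by (intro order_tendstoD(2)[OF L2_dist_heat_poly_tendsto]) simp
  then show "\<forall>\<^sub>F t in at_right 0. L2_dist (\<lambda>x. evol v x t) v < e"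
    using eventually_at_right_less
  proof eventually_elim
    case (elim t)
    have evol_L2: "L2 (\<lambda>x. evol v x t)" by (rule L2_evol[OF v elim(2)])
    have "L2_dist (\<lambda>x. evol v x t) (?w t) = L2_norm (\<lambda>x. evol (\<lambda>x. v x - ?w 0 x) x t)"
      unfolding L2_dist_eq_L2_norm
      by (intro l2_norm_cong) (simp add: evol_diff v L2_poly elim heat_poly_0 evol_eigenpoly_sum)
    also have "\<dots> \<le> L2_dist v (?w 0)"
      unfolding L2_dist_eq_L2_norm by (intro L2_norm_evol_le L2_diff L2_poly v elim)
    finally have "L2_dist (\<lambda>x. evol v x t) (?w t) < e / 3"
      using w by simp
    then show ?case
      using L2_dist_triangle[OF evol_L2 L2_poly v, of "heat_poly N a t"]
        L2_dist_triangle[OF L2_poly L2_poly v, of "heat_poly N a t" "heat_poly N a 0"]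
        w elim(1) L2_dist_commute[of v "?w 0"] by simp
  qed
qed

definition boundary_interpolant :: "real \<Rightarrow> real \<Rightarrow> real" where
  "boundary_interpolant p x = ((1 + x) + p * (1 - x)) / 2"

lemma boundary_interpolant_DERIV:
  "(boundary_interpolant p has_real_derivative (1 - p) / 2) (at x)"
  unfolding boundary_interpolant_def by (auto intro!: derivative_eq_intros)

lemma continuous_boundary_interpolant: "continuous_on A (boundary_interpolant p)"
  by (meson boundary_interpolant_DERIV DERIV_continuous continuous_at_imp_continuous_on)

lemma classical_solution_exists:
  assumes "L2 G0"
  shows "\<exists>G Gx Gxx. classical_solution lam p G0 G Gx Gxx"
proof (intro exI)
  define u where "u x = G0 x - boundary_interpolant p x" for x
  have u: "L2 u"
    unfolding u_def by (intro L2_diff L2_continuous continuous_boundary_interpolant assms)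
  let ?G = "\<lambda>x t. boundary_interpolant p x + evol u x t"
    and ?Gx = "\<lambda>x t. (1 - p) / 2 + evol_x u x t"
  show "classical_solution lam p G0 ?G ?Gx (evol_xx u)"
  proof
    show "continuous_up_to_boundary (evol_xx u)" by (rule continuous_evol(3)[OF u])
    show "continuous_up_to_boundary ?G" "continuous_up_to_boundary ?Gx"
      using continuous_evol(1,2)[OF u] unfolding split_beta
      by (intro continuous_intros
          continuous_on_compose2[OF continuous_boundary_interpolant[of UNIV]]; simp)+
    show "((\<lambda>x. ?G x t) has_real_derivative ?Gx x t) (at x)"
      "((\<lambda>x. ?Gx x t) has_real_derivative evol_xx u x t) (at x)" if "x \<in> Ioo11" "t > 0" for x t
      using evol_DERIV_x[OF u that] boundary_interpolant_DERIV[of p x]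
      by (auto intro: DERIV_add DERIV_const[THEN DERIV_add, simplified])
    show "((\<lambda>t. ?G x t) has_real_derivative lam / 2 * (1 - x\<^sup>2) * evol_xx u x t) (at t)"
      if "x \<in> {-1..1}" "t > 0" for x t
      using DERIV_add[OF DERIV_const evol_DERIV_t[OF u that]] by simp
    show "?G 1 t = 1" "?G (-1) t = p" for t
      by (simp_all add: boundary_interpolant_def)
    have "L2_dist (\<lambda>x. ?G x t) G0 = L2_dist (\<lambda>x. evol u x t) u" for t
      by (rule L2_dist_cong) (simp add: u_def)
    then show "((\<lambda>t. L2_dist (\<lambda>x. ?G x t) G0) \<longlongrightarrow> 0) (at_right 0)"
      using L2_dist_evol_tendsto_initial[OF u] by simp
  qed
qed

end

theorem theorem3p4:
  fixes lam p :: real and G0 :: "real \<Rightarrow> real"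
  assumes "lam > 0" and "L2 G0"
  shows "\<exists>G Gx. weak_solution lam G0 p G Gx \<and>
           (H1 G0 \<longrightarrow>
              (\<exists>Gxx. L2loc_H1rho Gx Gxx) \<and> C_H1 G \<and> dt_L2loc_L2 G)"
proof -
  interpret heat_flow lam
    using assms(1) by unfold_locales
  obtain G Gx Gxx where "classical_solution lam p G0 G Gx Gxx"
    using classical_solution_exists[OF assms(2)] by blast
  then interpret classical_solution lam p G0 G Gx Gxx .
  show ?thesis
    using weak_solution_G L2loc_H1rho_Gx C_H1_G dt_L2loc_L2_G by blast
qed

end
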